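(* Let $\alpha,\beta\in\mathcal{C}$ be such that $\alpha$ is not a constant multiple of $\beta$. Suppose $s^{[\alpha]}(1,\infty)=\int_1^\infty\frac{dx}{\alpha(x)^2}=\infty$. Then $\mathbb{P}^{[\alpha]}_x$ and $\mathbb{P}^{[\beta]}_x$ are singular on $\mathcal{F}_\infty$ for every $x>0$.
   Context: Path space. $\Omega$ is the set of functions $\omega:[0,\infty)\to(0,\infty)\cup\{\partial\}$ ($\partial$ an isolated cemetery point) that are continuous on $[0,\zeta(\omega))$ and equal to $\partial$ on $[\zeta(\omega),\infty)$, where $\zeta(\omega)=\inf\{t\ge 0\mid\omega(t)=\partial\}$. $X_t(\omega)=\omega(t)$, $\mathcal{F}_t=\bigcap_{s>t}\sigma(X_u,u\le s)$, $\mathcal{F}_\infty=\sigma(\bigcup_{t>0}\mathcal{F}_t)$. Every function $f$ on $(0,\infty)$ is extended by $f(\partial)=0$. $\mathbb{E}[Y,A]$ means $\mathbb{E}[Y1_A]$. The diffusion. $m$ is a Radon measure on $(0,\infty)$ with full support, and $X=((X_t),(\mathcal{F}_t),(\mathbb{P}_x)_{x>0})$ is the natural-scale diffusion on $(0,\infty)$ with generator $\frac{d}{dm}\frac{d^+}{dx}$ (speed measure $m$, scale function $s(x)=x$, no killing measure), killed exactly at $T_0=\lim_{x\to 0}T_x$, where $T_x=\inf\{t>0\mid X_t=x\}$. The boundary $0$ is regular or exit in Feller's sense (equivalently $\int_{(0,1]}x\,dm(x)<\infty$), and the boundary $\infty$ is entrance (equivalently $\int_{(1,\infty)}x\,dm(x)<\infty$)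 or natural (equivalently $\int_{(1,\infty)}x\,dm(x)=\infty$). Local generator. $f^+$ denotes the right-derivative. $\mathcal{D}(\mathcal{L})$ is the set of continuous $u:(0,\infty)\to\mathbb{R}$ for which there is a continuous $v$ with $u^+(b)-u^+(a)=\int_{(a,b]}v\,dm$ for $0<a<b$; then $\mathcal{L}u:=v$. Class $\mathcal{C}$. $\mathcal{C}$ is the set of functions $\rho:(0,\infty)\to(0,\infty)$ of the form $\rho(x)=\int_0^x dy\int_y^\infty\phi(z)\,dm(z)$ for some non-negative, continuous, $m$-integrable function $\phi$ that is not identically zero; then $\mathcal{L}\rho=-\phi$. $h$-transform. For $\rho\in\mathcal{C}$ put $M^{[\rho]}_t:=\frac{\rho(X_t)}{\rho(X_0)}\exp\big(-\int_0^t\frac{\mathcal{L}\rho(X_s)}{\rho(X_s)}ds\big)$. $(\mathbb{P}^{[\rho]}_x)_{x>0}$ denotes the distributions on $(\Omega,\mathcal{F}_\infty)$ of the diffusion with generator $L^{[\rho]}=\frac{d}{dm^{[\rho]}}\frac{d^+}{ds^{[\rho]}}$, where $dm^{[\rho]}=\rho^2dm$, $ds^{[\rho]}=dx/\rho^2$, with no killing measure and with the Dirichlet condition (killing) at a regular boundary; it is related to $\mathbb{P}_x$ by $\mathbb{P}^{[\rho]}_x[A\cap\{t<\zeta\}]=\mathbb{E}_x[M^{[\rho]}_t,A]$ for $A\in\mathcal{F}_t$. *)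

theory Defs
  imports "HOL-Probability.Probability"
begin

section \<open>Path space\<close>

text \<open>
  The state space is \<open>(0,\<infinity>) \<union> {\<partial>}\<close>, where \<open>None\<close> plays the role of the isolated
  cemetery \<open>\<partial>\<close> and \<open>Some x\<close> with \<open>x > 0\<close> that of the point \<open>x\<close>.
  Paths are functions on \<open>[0,\<infinity>)\<close>, encoded as extensional functions on \<open>{0..}\<close>.
\<close>

type_synonym path = "real \<Rightarrow> real option"

definition state_algebra :: "real option measure" where
  "state_algebra = sigma (insert None (Some ` {0<..}))
     {Some ` B | B. B \<in> sets borel \<and> B \<subseteq> {0<..}}"

definition extend0 :: "(real \<Rightarrow> real) \<Rightarrow> real option \<Rightarrow> real" where
  "extend0 f p = (case p of None \<Rightarrow> 0 | Some x \<Rightarrow> f x)"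

definition lifetime :: "path \<Rightarrow> ennreal" where
  "lifetime \<omega> = Inf (ennreal ` {t. 0 \<le> t \<and> \<omega> t = None})"

definition Omega :: "path set" where
  "Omega = {\<omega> \<in> {0..} \<rightarrow>\<^sub>E insert None (Some ` {0<..}).
     continuous_on {t. 0 \<le> t \<and> ennreal t < lifetime \<omega>} (\<lambda>t. the (\<omega> t)) \<and>
     (\<forall>t\<ge>0. lifetime \<omega> \<le> ennreal t \<longrightarrow> \<omega> t = None)}"

definition shift :: "real \<Rightarrow> path \<Rightarrow> path" where
  "shift s \<omega> = (\<lambda>t\<in>{0..}. \<omega> (s + t))"

definition hit :: "real \<Rightarrow> path \<Rightarrow> ennreal" where
  "hit a \<omega> = Inf (ennreal ` {t. 0 < t \<and> \<omega> t = Some a})"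

definition hit0 :: "path \<Rightarrow> ennreal" where
  "hit0 \<omega> = Lim (at_right 0) (\<lambda>a. hit a \<omega>)"


section \<open>Filtration\<close>

definition F_raw :: "real \<Rightarrow> path measure" where
  "F_raw s = sigma Omega
     {{\<omega> \<in> Omega. \<omega> u \<in> B} | u B. 0 \<le> u \<and> u \<le> s \<and> B \<in> sets state_algebra}"

definition F_at :: "real \<Rightarrow> path measure" where
  "F_at t = sigma Omega (\<Inter>s\<in>{t<..}. sets (F_raw s))"

definition F_inf :: "path measure" where
  "F_inf = sigma Omega (\<Union>t\<in>{0<..}. sets (F_at t))"

text \<open>
  The same filtration indexed by \<open>[0,\<infinity>]\<close>, so that the library's stopping times may take
  the value \<open>\<infinity>\<close>.
\<close>

definition Filt :: "ennreal \<Rightarrow> path measure" where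
  "Filt t = (if t = \<top> then F_inf else F_at (enn2real t))"

lemma space_F_raw [simp]: "space (F_raw s) = Omega"
  unfolding F_raw_def by (intro space_measure_of) auto

lemma sets_F_raw_subset: "sets (F_raw s) \<subseteq> Pow Omega"
  using sets.space_closed[of "F_raw s"] by simp

lemma F_at_Inter_subset: "(\<Inter>s\<in>{t<..}. sets (F_raw s)) \<subseteq> Pow Omega"
proof -
  have "(\<Inter>s\<in>{t<..}. sets (F_raw s)) \<subseteq> sets (F_raw (t + 1))"
    by (rule INF_lower) simp
  then show ?thesis
    using sets_F_raw_subset by blast
qed

lemma space_F_at [simp]: "space (F_at t) = Omega"
  unfolding F_at_def using F_at_Inter_subset by (intro space_measure_of)

lemma sets_F_at: "sets (F_at t) = (\<Inter>s\<in>{t<..}. sets (F_raw s))"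
proof -
  have "sigma_algebra Omega (\<Inter>s\<in>{t<..}. sets (F_raw s))"
  proof (unfold sigma_algebra_iff2, intro conjI ballI allI impI)
    show "(\<Inter>s\<in>{t<..}. sets (F_raw s)) \<subseteq> Pow Omega"
      by (rule F_at_Inter_subset)
    show "{} \<in> (\<Inter>s\<in>{t<..}. sets (F_raw s))"
      by simp
  next
    fix A assume "A \<in> (\<Inter>s\<in>{t<..}. sets (F_raw s))"
    then show "Omega - A \<in> (\<Inter>s\<in>{t<..}. sets (F_raw s))"
      using sets.compl_sets[of A "F_raw _"] by auto
  next
    fix A :: "nat \<Rightarrow> path set" assume "range A \<subseteq> (\<Inter>s\<in>{t<..}. sets (F_raw s))"
    then show "(\<Union>i. A i) \<in> (\<Inter>s\<in>{t<..}. sets (F_raw s))"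
      by (auto intro!: sets.countable_UN)
  qed
  then show ?thesis
    unfolding F_at_def by (rule sigma_algebra.sets_measure_of_eq)
qed

lemma F_inf_Union_subset: "(\<Union>t\<in>{0<..}. sets (F_at t)) \<subseteq> Pow Omega"
  using sets.space_closed[of "F_at _"] by auto

lemma space_F_inf [simp]: "space F_inf = Omega"
  unfolding F_inf_def using F_inf_Union_subset by (intro space_measure_of)

lemma sets_F_at_mono: "s \<le> t \<Longrightarrow> sets (F_at s) \<subseteq> sets (F_at t)"
  unfolding sets_F_at by (intro INF_superset_mono) auto

lemma sets_F_at_F_inf: "0 \<le> t \<Longrightarrow> sets (F_at t) \<subseteq> sets F_inf"
proof -
  assume "0 \<le> t"
  have "sets (F_at t) \<subseteq> sets (F_at (t + 1))"
    by (rule sets_F_at_mono) simp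
  also have "\<dots> \<subseteq> (\<Union>u\<in>{0<..}. sets (F_at u))"
    using \<open>0 \<le> t\<close> by (intro UN_upper) simp
  also have "\<dots> \<subseteq> sets F_inf"
    unfolding F_inf_def using F_inf_Union_subset by auto
  finally show ?thesis .
qed

global_interpretation Filt: filtration Omega Filt
proof
  show "space (Filt t) = Omega" for t
    by (simp add: Filt_def)
  show "sets (Filt s) \<subseteq> sets (Filt t)" if "s \<le> t" for s t
    using that
    by (auto simp: Filt_def top.extremum_unique less_top
        intro: subsetD[OF sets_F_at_F_inf[OF enn2real_nonneg]] subsetD[OF sets_F_at_mono] enn2real_mono)
qed


section \<open>One-dimensional diffusions\<close>

text \<open>Measures on \<open>(0,\<infinity>)\<close> live on the restricted Borel space.\<close>

abbreviation borel_pos :: "real measure" where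
  "borel_pos \<equiv> restrict_space borel {0<..}"

definition radon_full_support :: "real measure \<Rightarrow> bool" where
  "radon_full_support m \<longleftrightarrow> sets m = sets borel_pos \<and>
     (\<forall>K. compact K \<longrightarrow> K \<subseteq> {0<..} \<longrightarrow> emeasure m K < \<infinity>) \<and>
     (\<forall>U. open U \<longrightarrow> U \<subseteq> {0<..} \<longrightarrow> U \<noteq> {} \<longrightarrow> emeasure m U > 0)"

definition strong_Markov :: "(real \<Rightarrow> path measure) \<Rightarrow> bool" where
  "strong_Markov P \<longleftrightarrow>
     (\<forall>x>0. \<forall>\<tau>. stopping_time Filt \<tau> \<longrightarrow>
       (\<forall>A \<in> sets (Filt.pre_sigma \<tau>). \<forall>B \<in> sets F_inf.
          emeasure (P x) {\<omega> \<in> A. \<tau> \<omega> < lifetime \<omega> \<and> shift (enn2real (\<tau> \<omega>)) \<omega> \<in> B} =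
          (\<integral>\<^sup>+ \<omega> \<in> {\<omega> \<in> A. \<tau> \<omega> < lifetime \<omega>}.
             emeasure (P (the (\<omega> (enn2real (\<tau> \<omega>))))) B \<partial>P x)))"

text \<open>Green function of \<open>(d/dm) (d\<^sup>+/ds)\<close> on \<open>(a,b)\<close> with Dirichlet conditions.\<close>

definition green :: "(real \<Rightarrow> real) \<Rightarrow> real \<Rightarrow> real \<Rightarrow> real \<Rightarrow> real \<Rightarrow> real" where
  "green s a b x y = (s (min x y) - s a) * (s b - s (max x y)) / (s b - s a)"

text \<open>
  The diffusion on \<open>(0,\<infinity>)\<close> with generator \<open>(d/dm) (d\<^sup>+/ds)\<close>: a strong Markov family on the
  space of continuous paths with scale function \<open>s\<close> and speed measure \<open>m\<close>. Both are
  normalised by the generator, i.e. the mean exit time \<open>u\<close> from \<open>(a,b)\<close> solves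
  \<open>(d/dm) (d\<^sup>+/ds) u = -1\<close> (without a factor 2).
  The exit probabilities from \<open>(a,b)\<close> add up to 1, so there is no killing inside \<open>(0,\<infinity>)\<close>.
  As \<open>0\<close> and \<open>\<infinity>\<close> are not points of the state space and \<open>\<partial>\<close> is absorbing in \<open>Omega\<close>, a
  boundary point that is reached in finite time (in particular a regular one) is
  necessarily killing.
\<close>

definition diffusion ::
    "(real \<Rightarrow> real) \<Rightarrow> real measure \<Rightarrow> (real \<Rightarrow> path measure) \<Rightarrow> bool" where
  "diffusion s m P \<longleftrightarrow>
     P \<in> borel_pos \<rightarrow>\<^sub>M prob_algebra F_inf \<and>
     (\<forall>x>0. AE \<omega> in P x. \<omega> 0 = Some x) \<and>
     strong_Markov P \<and>
     (\<forall>a x b. 0 < a \<longrightarrow> a < x \<longrightarrow> x < b \<longrightarrow>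
        measure (P x) {\<omega> \<in> Omega. hit a \<omega> < hit b \<omega>} = (s b - s x) / (s b - s a) \<and>
        measure (P x) {\<omega> \<in> Omega. hit b \<omega> < hit a \<omega>} = (s x - s a) / (s b - s a) \<and>
        (\<integral>\<^sup>+ \<omega>. min (hit a \<omega>) (hit b \<omega>) \<partial>P x) =
          (\<integral>\<^sup>+ y \<in> {a<..<b}. ennreal (green s a b x y) \<partial>m))"

definition killed_at_0 :: "(real \<Rightarrow> path measure) \<Rightarrow> bool" where
  "killed_at_0 P \<longleftrightarrow> (\<forall>x>0. AE \<omega> in P x. lifetime \<omega> = hit0 \<omega>)"


section \<open>Feller's boundary classification in natural scale\<close>

text \<open>
  Feller's test integrals \<open>\<integral>\<integral> ds(x) dm(y)\<close> and \<open>\<integral>\<integral> dm(x) ds(y)\<close>, where \<open>y\<close> runs between \<open>x\<close>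
  and the reference point \<open>1\<close>. For \<open>s(x) = x\<close>, the boundary \<open>0\<close> is regular or exit iff
  \<open>\<integral>\<^bsub>(0,1]\<^esub> x dm(x) < \<infinity>\<close>, and \<open>\<infinity>\<close> is entrance or natural according as
  \<open>\<integral>\<^bsub>(1,\<infinity>)\<^esub> x dm(x)\<close> is finite or infinite.
\<close>

definition feller_sm_0 :: "real measure \<Rightarrow> ennreal" where
  "feller_sm_0 m = (\<integral>\<^sup>+ x \<in> {0<..1}. emeasure m {x<..1} \<partial>lborel)"

definition feller_ms_0 :: "real measure \<Rightarrow> ennreal" where
  "feller_ms_0 m = (\<integral>\<^sup>+ x \<in> {0<..1}. ennreal (1 - x) \<partial>m)"

definition feller_sm_inf :: "real measure \<Rightarrow> ennreal" where
  "feller_sm_inf m = (\<integral>\<^sup>+ x \<in> {1<..}. emeasure m {1<..x} \<partial>lborel)"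

definition feller_ms_inf :: "real measure \<Rightarrow> ennreal" where
  "feller_ms_inf m = (\<integral>\<^sup>+ x \<in> {1<..}. ennreal (x - 1) \<partial>m)"

definition regular_0 :: "real measure \<Rightarrow> bool" where
  "regular_0 m \<longleftrightarrow> feller_sm_0 m < \<infinity> \<and> feller_ms_0 m < \<infinity>"

definition exit_0 :: "real measure \<Rightarrow> bool" where
  "exit_0 m \<longleftrightarrow> feller_sm_0 m < \<infinity> \<and> feller_ms_0 m = \<infinity>"

definition entrance_inf :: "real measure \<Rightarrow> bool" where
  "entrance_inf m \<longleftrightarrow> feller_sm_inf m = \<infinity> \<and> feller_ms_inf m < \<infinity>"

definition natural_inf :: "real measure \<Rightarrow> bool" where
  "natural_inf m \<longleftrightarrow> feller_sm_inf m = \<infinity> \<and> feller_ms_inf m = \<infinity>"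


section \<open>Local generator, the class C and the h-transform\<close>

definition has_local_generator ::
    "real measure \<Rightarrow> (real \<Rightarrow> real) \<Rightarrow> (real \<Rightarrow> real) \<Rightarrow> bool" where
  "has_local_generator m u v \<longleftrightarrow>
     continuous_on {0<..} u \<and> continuous_on {0<..} v \<and>
     (\<exists>u'. (\<forall>x>0. (u has_real_derivative u' x) (at_right x)) \<and>
           (\<forall>a b. 0 < a \<longrightarrow> a < b \<longrightarrow> u' b - u' a = (LINT z:{a<..b}|m. v z)))"

text \<open>
  As \<open>m\<close> has full support, \<open>v\<close> is determined on \<open>(0,\<infinity>)\<close>; extensionality fixes the
  irrelevant values elsewhere.
\<close>

definition local_generator :: "real measure \<Rightarrow> (real \<Rightarrow> real) \<Rightarrow> real \<Rightarrow> real" where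
  "local_generator m u = (THE v. v \<in> extensional {0<..} \<and> has_local_generator m u v)"

definition class_C :: "real measure \<Rightarrow> (real \<Rightarrow> real) set" where
  "class_C m = {\<rho>. (\<forall>x>0. \<rho> x > 0) \<and>
     (\<exists>\<phi>. (\<forall>x>0. \<phi> x \<ge> 0) \<and> continuous_on {0<..} \<phi> \<and> integrable m \<phi> \<and> (\<exists>x>0. \<phi> x \<noteq> 0) \<and>
        (\<forall>x>0. \<rho> x = (LINT y:{0<..<x}|lborel. (LINT z:{y<..}|m. \<phi> z))))}"

definition h_mart :: "real measure \<Rightarrow> (real \<Rightarrow> real) \<Rightarrow> real \<Rightarrow> path \<Rightarrow> real" where
  "h_mart m \<rho> t \<omega> = extend0 \<rho> (\<omega> t) / extend0 \<rho> (\<omega> 0) *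
     exp (- (LINT s:{0..t}|lborel. extend0 (\<lambda>x. local_generator m \<rho> x / \<rho> x) (\<omega> s)))"

definition h_scale :: "(real \<Rightarrow> real) \<Rightarrow> real \<Rightarrow> real" where
  "h_scale \<rho> x = (LBINT y=1..x. 1 / (\<rho> y)\<^sup>2)"

definition h_speed :: "real measure \<Rightarrow> (real \<Rightarrow> real) \<Rightarrow> real measure" where
  "h_speed m \<rho> = density m (\<lambda>x. ennreal ((\<rho> x)\<^sup>2))"

definition h_transform ::
    "real measure \<Rightarrow> (real \<Rightarrow> path measure) \<Rightarrow> (real \<Rightarrow> real) \<Rightarrow> (real \<Rightarrow> path measure) \<Rightarrow> bool" where
  "h_transform m P \<rho> Q \<longleftrightarrow>
     diffusion (h_scale \<rho>) (h_speed m \<rho>) Q \<and>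
     (\<forall>x>0. \<forall>t\<ge>0. \<forall>A \<in> sets (F_at t).
        emeasure (Q x) {\<omega> \<in> A. ennreal t < lifetime \<omega>} =
        (\<integral>\<^sup>+ \<omega> \<in> A. ennreal (h_mart m \<rho> t \<omega>) \<partial>P x))"

definition singular_on :: "'a measure \<Rightarrow> 'a measure \<Rightarrow> 'a measure \<Rightarrow> bool" where
  "singular_on G \<mu> \<nu> \<longleftrightarrow> (\<exists>A \<in> sets G. emeasure \<mu> A = 0 \<and> emeasure \<nu> (space G - A) = 0)"

end

theory Submission
  imports Defs
begin

text \<open>
  The scale function \<open>s\<close> of the \<open>\<rho>\<close>-transform has derivative \<open>1 / \<rho>\<^sup>2\<close>, and \<open>s\<close> can be read off a
  single path, because the exit probabilities from intervals are ratios of increments of \<open>s\<close> and a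
  recurrent path contains infinitely many independent experiments with these probabilities.
  Since \<open>\<alpha>\<close> and \<open>\<beta>\<close> are not proportional, their scale functions are not affinely related, and the
  two laws are told apart.

  Near \<open>0\<close> a function \<open>\<rho>\<close> of class \<open>\<C>\<close> grows at most linearly, so the scale function tends to
  \<open>-\<infinity>\<close> there (\<open>h_scale_at_0\<close>). Together with the divergence of \<open>\<integral> 1 / \<alpha>\<^sup>2\<close> at \<open>\<infinity>\<close> this makes \<open>P\<alpha>\<close>
  recurrent: every level is hit almost surely (\<open>recurrent_hits\<close>). There are two cases for \<open>\<beta>\<close>.

  If the scale function of \<open>\<beta>\<close> is bounded above, then the path has under \<open>P\<beta>\<close> a probability to
  visit \<open>a\<close> that vanishes as \<open>a \<rightarrow> 0\<close>, while this probability is \<open>1\<close> under \<open>P\<alpha>\<close>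
  (\<open>recurrent_transient_singular\<close>).

  Otherwise both diffusions are recurrent. Choose \<open>a < x < b\<close> such that the probabilities \<open>p\<close> and
  \<open>q\<close> of hitting \<open>a\<close> before \<open>b\<close> differ (\<open>exit_ratio_differs\<close>). The path started at \<open>x\<close> runs through
  infinitely many cycles \<open>x \<rightarrow> a \<rightarrow> x\<close>, and by the strong Markov property the events that \<open>b\<close> is
  avoided on the way to \<open>a\<close> are independent Bernoulli trials, with parameter \<open>p\<close> under \<open>P\<alpha>\<close> and \<open>q\<close>
  under \<open>P\<beta>\<close>. In place of the law of large numbers, the proof uses the square root \<open>W\<close> of the
  likelihood ratio of the first \<open>k\<close> trials. Both the \<open>P\<alpha>\<close>-mean of \<open>W\<close> and the \<open>P\<beta>\<close>-mean of
  \<open>1 / W\<close> equal \<open>h ^ k\<close>, where \<open>h = sqrt (p q) + sqrt ((1 - p) (1 - q)) < 1\<close> is the Hellinger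
  affinity of the two Bernoulli laws. By Markov's inequality the event \<open>W \<ge> 1\<close> has probability at
  most \<open>h ^ k\<close> under \<open>P\<alpha>\<close>, and its complement has probability at most \<open>h ^ k\<close> under \<open>P\<beta>\<close>; letting
  \<open>k \<rightarrow> \<infinity>\<close> gives singularity (\<open>singular_on_approx\<close>, \<open>recurrent_recurrent_singular\<close>).
\<close>

section \<open>Paths as real functions\<close>

text \<open>
  The coordinate process with the cemetery sent to \<open>0\<close>. As the states are positive, this loses no
  information on the path space, and it makes limits and Borel measurability available.
\<close>

definition pos :: "real \<Rightarrow> path \<Rightarrow> real" where
  "pos t \<omega> = extend0 (\<lambda>x. x) (\<omega> t)"

lemma pos_eq_0_iff: "\<omega> \<in> Omega \<Longrightarrow> 0 \<le> t \<Longrightarrow> pos t \<omega> = 0 \<longleftrightarrow> \<omega> t = None"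
  and pos_nonneg: "\<omega> \<in> Omega \<Longrightarrow> 0 \<le> t \<Longrightarrow> 0 \<le> pos t \<omega>"
  and pos_eq_iff: "\<omega> \<in> Omega \<Longrightarrow> 0 \<le> t \<Longrightarrow> 0 < a \<Longrightarrow> pos t \<omega> = a \<longleftrightarrow> \<omega> t = Some a"
proof -
  assume *: "\<omega> \<in> Omega" "0 \<le> t"
  then have "\<omega> t \<in> insert None (Some ` {0<..})"
    by (auto simp: Omega_def PiE_iff)
  then show "pos t \<omega> = 0 \<longleftrightarrow> \<omega> t = None" "0 \<le> pos t \<omega>"
    "0 < a \<Longrightarrow> pos t \<omega> = a \<longleftrightarrow> \<omega> t = Some a"
    by (auto simp: pos_def extend0_def)
qed

lemma pos_gt_0_iff_alive:
  assumes "\<omega> \<in> Omega" "0 \<le> t"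
  shows "0 < pos t \<omega> \<longleftrightarrow> ennreal t < lifetime \<omega>"
proof -
  have "lifetime \<omega> \<le> ennreal t" if "\<omega> t = None"
    unfolding lifetime_def using that assms by (intro Inf_lower) auto
  moreover have "\<omega> t = None" if "lifetime \<omega> \<le> ennreal t"
    using that assms by (auto simp: Omega_def)
  ultimately show ?thesis
    using pos_eq_0_iff[OF assms] pos_nonneg[OF assms] by (metis less_le not_le)
qed

lemma alive_before:
  assumes "\<omega> \<in> Omega" "0 \<le> s" "s \<le> t" "0 < pos t \<omega>"
  shows "0 < pos s \<omega>"
  using assms pos_gt_0_iff_alive[of \<omega> s] pos_gt_0_iff_alive[of \<omega> t]
  by (meson ennreal_leI order_le_less_trans order_trans)

lemma continuous_on_pos:
  assumes "\<omega> \<in> Omega"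
  shows "continuous_on {t. 0 \<le> t \<and> ennreal t < lifetime \<omega>} (\<lambda>t. pos t \<omega>)"
proof -
  have "continuous_on {t. 0 \<le> t \<and> ennreal t < lifetime \<omega>} (\<lambda>t. the (\<omega> t))"
    using assms by (auto simp: Omega_def)
  moreover have "the (\<omega> t) = pos t \<omega>" if "0 \<le> t" "ennreal t < lifetime \<omega>" for t
    using that pos_gt_0_iff_alive[OF assms that(1)] by (auto simp: pos_def extend0_def split: option.splits)
  ultimately show ?thesis
    by (simp cong: continuous_on_cong_simp)
qed

text \<open>
  Before the lifetime this is continuity, and from the lifetime on the path is constant. At the
  lifetime itself the left limit may be anything, so right continuity is all that holds.
\<close>

lemma pos_right_continuous:
  assumes "\<omega> \<in> Omega" "0 \<le> t"
  shows "((\<lambda>s. pos s \<omega>) \<longlongrightarrow> pos t \<omega>) (at_right t)"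
proof (cases "0 < pos t \<omega>")
  case True
  let ?A = "{t. 0 \<le> t \<and> ennreal t < lifetime \<omega>}"
  have tA: "t \<in> ?A"
    using True assms pos_gt_0_iff_alive by auto
  obtain u where u: "t < u" "{t..u} \<subseteq> ?A"
  proof -
    from tA obtain l where l: "ennreal t < l" "l < lifetime \<omega>"
      using dense by blast
    then have lt: "l < \<top>" by (meson less_top_ennreal order.strict_trans2 top_greatest)
    show ?thesis
    proof (rule that[of "enn2real l"])
      show "t < enn2real l"
        using l lt assms(2) by (cases l) (auto simp: ennreal_less_iff)
      show "{t..enn2real l} \<subseteq> ?A"
        using l lt assms(2)
        by (cases l) (auto intro: order.strict_trans1[OF ennreal_leI])
    qed
  qed
  have "continuous_on {t..u} (\<lambda>t. pos t \<omega>)"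
    using continuous_on_pos[OF assms(1)] u(2) continuous_on_subset by blast
  then have "((\<lambda>s. pos s \<omega>) \<longlongrightarrow> pos t \<omega>) (at t within {t..u})"
    using u(1) by (auto simp: continuous_on_def)
  then show ?thesis
    using u(1) by (simp add: at_within_Icc_at_right)
next
  case False
  have "pos s \<omega> = pos t \<omega>" if "t < s" for s
    using False alive_before[OF assms(1,2), of s] that pos_nonneg[OF assms(1)] assms(2)
    by (metis less_le order.trans)
  then have "eventually (\<lambda>s. pos s \<omega> = pos t \<omega>) (at_right t)"
    by (auto simp: eventually_at_right_field intro: exI[of _ "t + 1"])
  then show ?thesis
    by (rule tendsto_eventually)
qed

text \<open>
  The delicate point is that the shifted path is already at the cemetery at its own lifetime: a
  path that is alive at a time stays alive for a while, by right continuity, so its lifetime lies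
  strictly beyond that time.
\<close>

lemma shift_Omega:
  assumes "\<omega> \<in> Omega" "0 \<le> s"
  shows "shift s \<omega> \<in> Omega"
proof -
  have app: "shift s \<omega> t = \<omega> (s + t)" if "0 \<le> t" for t
    using that by (simp add: shift_def)
  have alive: "\<omega> (s + t) \<noteq> None \<longleftrightarrow> ennreal (s + t) < lifetime \<omega>" if "0 \<le> t" for t
    using pos_gt_0_iff_alive[OF assms(1), of "s + t"] pos_eq_0_iff[OF assms(1), of "s + t"]
      pos_nonneg[OF assms(1), of "s + t"] that assms(2) by (auto simp: less_le)
  have "shift s \<omega> \<in> {0..} \<rightarrow>\<^sub>E insert None (Some ` {0<..})"
    using assms by (auto simp: shift_def Omega_def PiE_iff extensional_def)
  moreover have "continuous_on {t. 0 \<le> t \<and> ennreal t < lifetime (shift s \<omega>)} (\<lambda>t. the (shift s \<omega> t))"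
  proof -
    have *: "ennreal (s + t) < lifetime \<omega>" if "0 \<le> t" "ennreal t < lifetime (shift s \<omega>)" for t
    proof (subst alive[OF that(1), symmetric], rule notI)
      assume "\<omega> (s + t) = None"
      then have "lifetime (shift s \<omega>) \<le> ennreal t"
        unfolding lifetime_def using that(1) app by (intro Inf_lower) auto
      with that(2) show False by simp
    qed
    have "continuous_on {t. 0 \<le> t \<and> ennreal t < lifetime \<omega>} (\<lambda>t. the (\<omega> t))"
      using assms(1) by (auto simp: Omega_def)
    then have "continuous_on {t. 0 \<le> t \<and> ennreal t < lifetime (shift s \<omega>)} (\<lambda>t. the (\<omega> (s + t)))"
      by (rule continuous_on_compose2) (use * assms(2) in \<open>auto intro!: continuous_intros\<close>)
    then show ?thesis
      by (rule continuous_on_cong[THEN iffD1, rotated 2]) (auto simp: app)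
  qed
  moreover have "shift s \<omega> t = None" if "0 \<le> t" "lifetime (shift s \<omega>) \<le> ennreal t" for t
  proof (rule ccontr)
    assume "shift s \<omega> t \<noteq> None"
    then have "ennreal (s + t) < lifetime \<omega>"
      using alive app that(1) by simp
    then have "0 < pos (s + t) \<omega>"
      using pos_gt_0_iff_alive[OF assms(1), of "s + t"] that(1) assms(2) by simp
    then have "eventually (\<lambda>r. 0 < pos r \<omega>) (at_right (s + t))"
      using pos_right_continuous[OF assms(1), of "s + t"] that(1) assms(2)
      by (intro order_tendstoD(1)) auto
    then obtain b where b: "s + t < b" "\<And>r. s + t < r \<Longrightarrow> r < b \<Longrightarrow> 0 < pos r \<omega>"
      by (auto simp: eventually_at_right_field)
    define r where "r = (s + t + b) / 2"
    have r: "s + t < r" "0 < pos r \<omega>"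
      using b(1) b(2)[of r] by (auto simp: r_def)
    have "ennreal (r - s) \<le> lifetime (shift s \<omega>)"
      unfolding lifetime_def
    proof (safe intro!: Inf_greatest ennreal_leI)
      fix t' assume t': "0 \<le> t'" "shift s \<omega> t' = None"
      show "r - s \<le> t'"
      proof (rule ccontr)
        assume "\<not> r - s \<le> t'"
        then have "0 < pos (s + t') \<omega>"
          using alive_before[OF assms(1), of "s + t'" r] r t' assms(2) by auto
        then show False
          using t' app pos_eq_0_iff[OF assms(1), of "s + t'"] assms(2) by simp
      qed
    qed
    moreover have "ennreal t < ennreal (r - s)"
      using r that(1) by (simp add: ennreal_less_iff)
    ultimately show False
      using that(2) by (meson leD order.trans)
  qed
  ultimately show ?thesis
    by (auto simp: Omega_def)
qed

lemma hit_less_iff: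
  assumes "\<omega> \<in> Omega" "0 < a"
  shows "hit a \<omega> < ennreal u \<longleftrightarrow> (\<exists>t. 0 < t \<and> t < u \<and> pos t \<omega> = a)"
  unfolding hit_def Inf_less_iff
  using pos_eq_iff[OF assms(1) _ assms(2)] by (auto simp: ennreal_less_iff intro!: less_imp_le)

text \<open>
  The level \<open>a\<close> is attained at times arbitrarily close to the infimum, from the right, so right
  continuity makes the infimum a hitting time (also when it is \<open>0\<close>).
\<close>

lemma hit_attained:
  assumes "\<omega> \<in> Omega" "0 < a" "hit a \<omega> < \<top>"
  shows "pos (enn2real (hit a \<omega>)) \<omega> = a"
proof (rule ccontr)
  define \<tau> where "\<tau> = enn2real (hit a \<omega>)"
  have \<tau>: "hit a \<omega> = ennreal \<tau>" "0 \<le> \<tau>"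
    using assms(3) by (auto simp: \<tau>_def less_top)
  assume "pos (enn2real (hit a \<omega>)) \<omega> \<noteq> a"
  then have ne: "pos \<tau> \<omega> \<noteq> a" by (simp add: \<tau>_def)
  have "eventually (\<lambda>s. pos s \<omega> \<noteq> a) (at_right \<tau>)"
    using pos_right_continuous[OF assms(1) \<tau>(2)] ne by (rule tendsto_imp_eventually_ne)
  then obtain b where b: "\<tau> < b" "\<And>r. \<tau> < r \<Longrightarrow> r < b \<Longrightarrow> pos r \<omega> \<noteq> a"
    by (auto simp: eventually_at_right_field)
  have "hit a \<omega> < ennreal b"
    using b(1) \<tau> by (simp add: ennreal_less_iff)
  then obtain t where t: "0 < t" "t < b" "pos t \<omega> = a"
    using hit_less_iff[OF assms(1,2)] by auto
  then have "hit a \<omega> \<le> ennreal t"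
    unfolding hit_def using pos_eq_iff[OF assms(1) _ assms(2), of t] by (intro Inf_lower) auto
  then have "\<tau> \<le> t"
    using t(1) by (simp add: \<tau>)
  with t b(2) ne show False
    by (cases "\<tau> = t") auto
qed

lemma hit_less_lifetime:
  assumes "\<omega> \<in> Omega" "0 < a" "hit a \<omega> < \<top>"
  shows "hit a \<omega> < lifetime \<omega>"
  using hit_attained[OF assms] pos_gt_0_iff_alive[OF assms(1), of "enn2real (hit a \<omega>)"] assms
  by simp

lemma path_at_hit:
  assumes "\<omega> \<in> Omega" "0 < a" "hit a \<omega> < \<top>"
  shows "\<omega> (enn2real (hit a \<omega>)) = Some a"
  using hit_attained[OF assms] pos_eq_iff[OF assms(1) _ assms(2)] by simp

section \<open>Hitting times and the restarted path\<close>

lemma state_algebra_gen: 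
  "{Some ` B | B. B \<in> sets borel \<and> B \<subseteq> {0<..}} \<subseteq> Pow (insert None (Some ` {0::real<..}))"
  by auto

lemma space_state_algebra: "space state_algebra = insert None (Some ` {0<..})"
  unfolding state_algebra_def using state_algebra_gen by (rule space_measure_of)

lemma measurable_extend0_id: "extend0 (\<lambda>x. x) \<in> borel_measurable state_algebra"
proof (rule measurableI)
  fix B :: "real set" assume B: "B \<in> sets borel"
  have *: "Some ` C \<in> sets state_algebra" if "C \<in> sets borel" "C \<subseteq> {0<..}" for C :: "real set"
    unfolding state_algebra_def using that by (intro in_measure_of state_algebra_gen) auto
  have "space state_algebra - Some ` {0<..} \<in> sets state_algebra"
    by (intro sets.compl_sets *) auto
  then have None: "{None} \<in> sets state_algebra"
    by (simp add: space_state_algebra insert_Diff_if image_iff)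
  have "extend0 (\<lambda>x. x) -` B \<inter> space state_algebra
      = Some ` (B \<inter> {0<..}) \<union> (if 0 \<in> B then {None} else {})"
    by (auto simp: extend0_def space_state_algebra)
  also have "\<dots> \<in> sets state_algebra"
  proof (rule sets.Un)
    show "Some ` (B \<inter> {0<..}) \<in> sets state_algebra"
      using B by (intro *) auto
  qed (use None in auto)
  finally show "extend0 (\<lambda>x. x) -` B \<inter> space state_algebra \<in> sets state_algebra" .
qed simp

text \<open>
  The trace of the Borel sets on the positive half line generates the state algebra, so
  measurability into it can be tested on real values.
\<close>

lemma measurable_state_algebraI:
  assumes "\<And>x. x \<in> space N \<Longrightarrow> f x \<in> insert None (Some ` {0<..})"
    and m: "(\<lambda>x. extend0 (\<lambda>x. x) (f x)) \<in> borel_measurable N"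
  shows "f \<in> measurable N state_algebra"
  unfolding state_algebra_def
proof (rule measurable_measure_of[OF state_algebra_gen])
  show "f \<in> space N \<rightarrow> insert None (Some ` {0<..})"
    using assms by auto
  fix A assume "A \<in> {Some ` B | B. B \<in> sets borel \<and> B \<subseteq> {0::real<..}}"
  then obtain B where B: "A = Some ` B" "B \<in> sets borel" "B \<subseteq> {0<..}" by auto
  have "f -` A \<inter> space N = (\<lambda>x. extend0 (\<lambda>x. x) (f x)) -` B \<inter> space N"
    using B assms(1) by (auto simp: extend0_def split: option.splits)
  then show "f -` A \<inter> space N \<in> sets N"
    using measurable_sets[OF m B(2)] by simp
qed

lemma F_raw_gen:
  "{{\<omega> \<in> Omega. \<omega> u \<in> B} | u B. 0 \<le> u \<and> u \<le> s \<and> B \<in> sets state_algebra} \<subseteq> Pow Omega"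
  by auto

lemma sets_F_raw_mono: "s \<le> t \<Longrightarrow> sets (F_raw s) \<subseteq> sets (F_raw t)"
  unfolding F_raw_def sets_measure_of[OF F_raw_gen]
  by (rule sigma_sets_mono') (force intro: order_trans)

lemma sets_F_raw_F_at: "sets (F_raw s) \<subseteq> sets (F_at s)"
  unfolding sets_F_at by (auto dest: subsetD[OF sets_F_raw_mono, rotated] intro: less_imp_le)

lemma sets_F_raw_F_inf: "0 \<le> s \<Longrightarrow> sets (F_raw s) \<subseteq> sets F_inf"
  using sets_F_raw_F_at sets_F_at_F_inf by blast

lemma pos_measurable_F_raw:
  assumes "0 \<le> u" "u \<le> s"
  shows "pos u \<in> borel_measurable (F_raw s)"
proof -
  have "(\<lambda>\<omega>. \<omega> u) \<in> measurable (F_raw s) state_algebra"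
  proof (rule measurableI)
    fix \<omega> assume "\<omega> \<in> space (F_raw s)"
    then show "\<omega> u \<in> space state_algebra"
      using assms by (auto simp: space_state_algebra Omega_def PiE_iff)
  next
    fix B assume "B \<in> sets state_algebra"
    moreover have "(\<lambda>\<omega>. \<omega> u) -` B \<inter> space (F_raw s) = {\<omega> \<in> Omega. \<omega> u \<in> B}"
      by auto
    ultimately show "(\<lambda>\<omega>. \<omega> u) -` B \<inter> space (F_raw s) \<in> sets (F_raw s)"
      unfolding F_raw_def using assms by (auto intro!: in_measure_of F_raw_gen)
  qed
  from measurable_compose[OF this measurable_extend0_id] show ?thesis
    by (simp add: pos_def[abs_def])
qed

lemma pos_measurable_F_inf: "0 \<le> u \<Longrightarrow> pos u \<in> borel_measurable F_inf"
  using pos_measurable_F_raw[of u u] sets_F_raw_F_inf[of u] measurable_mono[of borel borel "F_raw u" F_inf]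
  by auto

text \<open>
  By right continuity the value at a random time is the limit of the values at the next
  grid point strictly to the right, and these are countable patchworks of coordinates.
\<close>

lemma pos_at_random_time_measurable:
  assumes T: "T \<in> borel_measurable F_inf" and T0: "\<And>\<omega>. 0 \<le> T \<omega>"
  shows "(\<lambda>\<omega>. pos (T \<omega>) \<omega>) \<in> borel_measurable F_inf"
proof (rule borel_measurable_LIMSEQ_real)
  define k where "k n \<omega> = nat \<lfloor>real (Suc n) * T \<omega>\<rfloor>" for n \<omega>
  define t where "t n j = (real j + 1) / real (Suc n)" for n j :: nat
  show "(\<lambda>\<omega>. pos (t n (k n \<omega>)) \<omega>) \<in> borel_measurable F_inf" for n
  proof (rule measurable_compose_countable[where f="\<lambda>j \<omega>. pos (t n j) \<omega>"])
    show "k n \<in> measurable F_inf (count_space UNIV)"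
      unfolding k_def using T by measurable
    show "pos (t n j) \<in> borel_measurable F_inf" for j
      by (rule pos_measurable_F_inf) (simp add: t_def)
  qed
  fix \<omega> assume \<omega>: "\<omega> \<in> space F_inf"
  have b: "T \<omega> < t n (k n \<omega>)" "t n (k n \<omega>) \<le> T \<omega> + 1 / real (Suc n)" for n
  proof -
    have f: "real (k n \<omega>) = of_int \<lfloor>real (Suc n) * T \<omega>\<rfloor>"
      using T0 by (simp add: k_def)
    have "real (Suc n) * T \<omega> < real (k n \<omega>) + 1" "real (k n \<omega>) \<le> real (Suc n) * T \<omega>"
      unfolding f by linarith+
    then show "T \<omega> < t n (k n \<omega>)" "t n (k n \<omega>) \<le> T \<omega> + 1 / real (Suc n)"
      unfolding t_def by (simp_all add: field_simps del: of_nat_Suc)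
  qed
  have "(\<lambda>n. t n (k n \<omega>)) \<longlonglongrightarrow> T \<omega>"
  proof (rule tendsto_sandwich[of "\<lambda>_. T \<omega>" _ _ "\<lambda>n. T \<omega> + 1 / real (Suc n)"])
    show "(\<lambda>n. T \<omega> + 1 / real (Suc n)) \<longlonglongrightarrow> T \<omega>"
      using tendsto_add[OF tendsto_const[of "T \<omega>"] LIMSEQ_Suc[OF lim_1_over_n]] by simp
  qed (use b in \<open>auto intro!: always_eventually less_imp_le\<close>)
  moreover have "t n (k n \<omega>) \<noteq> T \<omega>" for n
    using b(1)[of n] by simp
  ultimately have "filterlim (\<lambda>n. t n (k n \<omega>)) (at_right (T \<omega>)) sequentially"
    unfolding filterlim_at using b by (auto intro!: always_eventually)
  from filterlim_compose[OF pos_right_continuous this]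
  show "(\<lambda>n. pos (t n (k n \<omega>)) \<omega>) \<longlonglongrightarrow> pos (T \<omega>) \<omega>"
    using \<omega> T0 by auto
qed

text \<open>
  The level is hit before time \<open>u\<close> iff, on some rational time interval \<open>[d, r]\<close> with \<open>0 < d < r < u\<close>
  at whose end the path is alive, it comes arbitrarily close to \<open>a\<close> at rational times. That the path
  is alive at \<open>r\<close> matters: it gives continuity on the compact interval, whereas a path could
  approach \<open>a\<close> at its lifetime without ever being there.
\<close>

lemma hit_less_measurable:
  assumes "0 < a"
  shows "{\<omega> \<in> Omega. hit a \<omega> < ennreal u} \<in> sets (F_raw u)"
proof -
  define S where "S d r = {\<omega> \<in> Omega. 0 < pos r \<omega> \<and>
     (\<forall>k::nat. \<exists>q\<in>{q \<in> \<rat>. d \<le> q \<and> q \<le> r}. \<bar>pos q \<omega> - a\<bar> < 1 / real (Suc k))}" for d r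
  have "{\<omega> \<in> Omega. hit a \<omega> < ennreal u} =
     (\<Union>d\<in>{d \<in> \<rat>. 0 < d}. \<Union>r\<in>{r \<in> \<rat>. d < r \<and> r < u}. S d r)"
  proof (intro equalityI subsetI)
    fix \<omega> assume "\<omega> \<in> {\<omega> \<in> Omega. hit a \<omega> < ennreal u}"
    then have \<omega>: "\<omega> \<in> Omega" and "hit a \<omega> < ennreal u" by auto
    then obtain t where t: "0 < t" "t < u" "pos t \<omega> = a"
      using hit_less_iff[OF \<omega> assms] by auto
    have lim: "((\<lambda>s. pos s \<omega>) \<longlongrightarrow> a) (at_right t)"
      using pos_right_continuous[OF \<omega>, of t] t by simp
    obtain d where d: "d \<in> \<rat>" "0 < d" "d < t"
      using Rats_dense_in_real[OF t(1)] by auto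
    have "eventually (\<lambda>s. 0 < pos s \<omega>) (at_right t)"
      using lim assms by (rule order_tendstoD)
    then obtain b where b: "t < b" "\<And>s. t < s \<Longrightarrow> s < b \<Longrightarrow> 0 < pos s \<omega>"
      by (auto simp: eventually_at_right_field)
    obtain r where r: "r \<in> \<rat>" "t < r" "r < min b u"
      using Rats_dense_in_real[of t "min b u"] b(1) t(2) by auto
    have "\<exists>q\<in>{q \<in> \<rat>. d \<le> q \<and> q \<le> r}. \<bar>pos q \<omega> - a\<bar> < 1 / real (Suc k)" for k
    proof -
      have "eventually (\<lambda>s. dist (pos s \<omega>) a < 1 / real (Suc k)) (at_right t)"
        using lim by (rule tendstoD) simp
      then obtain c where c: "t < c" "\<And>s. t < s \<Longrightarrow> s < c \<Longrightarrow> dist (pos s \<omega>) a < 1 / real (Suc k)"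
        by (auto simp: eventually_at_right_field)
      obtain q where "q \<in> \<rat>" "t < q" "q < min c r"
        using Rats_dense_in_real[of t "min c r"] c(1) r(2) by auto
      then show ?thesis
        using c(2)[of q] d by (auto simp: dist_real_def intro!: bexI[of _ q])
    qed
    then show "\<omega> \<in> (\<Union>d\<in>{d \<in> \<rat>. 0 < d}. \<Union>r\<in>{r \<in> \<rat>. d < r \<and> r < u}. S d r)"
      using \<omega> d r b(2)[of r] unfolding S_def
      by (intro UN_I[of d] UN_I[of r]) auto
  next
    fix \<omega> assume "\<omega> \<in> (\<Union>d\<in>{d \<in> \<rat>. 0 < d}. \<Union>r\<in>{r \<in> \<rat>. d < r \<and> r < u}. S d r)"
    then obtain d r where \<omega>: "\<omega> \<in> Omega" and dr: "0 < d" "d < r" "r < u" "0 < pos r \<omega>"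
      and app: "\<And>k::nat. \<exists>q. d \<le> q \<and> q \<le> r \<and> \<bar>pos q \<omega> - a\<bar> < 1 / real (Suc k)"
      unfolding S_def by blast
    have "ennreal s < lifetime \<omega>" if "d \<le> s" "s \<le> r" for s
      using that dr alive_before[OF \<omega>, of s r] pos_gt_0_iff_alive[OF \<omega>, of s] by auto
    then have "continuous_on {d..r} (\<lambda>s. pos s \<omega>)"
      using dr by (intro continuous_on_subset[OF continuous_on_pos[OF \<omega>]]) auto
    then have "continuous_on {d..r} (\<lambda>s. \<bar>pos s \<omega> - a\<bar>)"
      by (intro continuous_intros)
    then obtain s where s: "s \<in> {d..r}" "\<And>q. q \<in> {d..r} \<Longrightarrow> \<bar>pos s \<omega> - a\<bar> \<le> \<bar>pos q \<omega> - a\<bar>"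
      using continuous_attains_inf[of "{d..r}" "\<lambda>s. \<bar>pos s \<omega> - a\<bar>"] dr(2)
      by (metis atLeastAtMost_iff compact_Icc empty_iff less_imp_le order_refl)
    have "\<bar>pos s \<omega> - a\<bar> < 1 / real (Suc k)" for k
      using app[of k] s(2) by (auto intro: order.strict_trans1)
    then have "\<bar>pos s \<omega> - a\<bar> = 0"
      by (metis abs_ge_zero nat_approx_posE less_le not_less_iff_gr_or_eq)
    then show "\<omega> \<in> {\<omega> \<in> Omega. hit a \<omega> < ennreal u}"
      using \<omega> s(1) dr hit_less_iff[OF \<omega> assms, of u] by (auto intro!: exI[of _ s])
  qed
  also have "\<dots> \<in> sets (F_raw u)"
  proof (rule sets.countable_UN'', rule countable_Collect[OF countable_rat], rule sets.countable_UN'', rule countable_Collect[OF countable_rat])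
    fix d r assume "d \<in> {d \<in> \<rat>. 0 < d}" "r \<in> {r \<in> \<rat>. d < r \<and> r < u}"
    then have [measurable]: "pos q \<in> borel_measurable (F_raw u)" if "d \<le> q" "q \<le> r" for q
      using that by (intro pos_measurable_F_raw) auto
    have [measurable]: "pos r \<in> borel_measurable (F_raw u)"
      using \<open>r \<in> _\<close> by simp
    have near: "Measurable.pred (F_raw u)
        (\<lambda>\<omega>. \<forall>k::nat. \<exists>q\<in>{q \<in> \<rat>. d \<le> q \<and> q \<le> r}. \<bar>pos q \<omega> - a\<bar> < 1 / real (Suc k))"
    proof (intro pred_intros_countable(1) measurable_pred_countable(2) countable_Collect countable_rat)
      fix k :: nat and q assume "q \<in> {q \<in> \<rat>. d \<le> q \<and> q \<le> r}"
      then have [measurable]: "pos q \<in> borel_measurable (F_raw u)" by simp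
      show "Measurable.pred (F_raw u) (\<lambda>\<omega>. \<bar>pos q \<omega> - a\<bar> < 1 / real (Suc k))" by measurable
    qed
    have "Measurable.pred (F_raw u) (\<lambda>\<omega>. 0 < pos r \<omega> \<and>
        (\<forall>k::nat. \<exists>q\<in>{q \<in> \<rat>. d \<le> q \<and> q \<le> r}. \<bar>pos q \<omega> - a\<bar> < 1 / real (Suc k)))"
      by (intro pred_intros_logic(3) near) measurable
    then show "S d r \<in> sets (F_raw u)"
      by (simp add: S_def pred_def)
  qed
  finally show ?thesis .
qed

text \<open>
  Hitting times of points are stopping times because the filtration is right-continuous: hitting
  by time \<open>r\<close> means hitting before each later time.
\<close>

lemma stopping_time_hit:
  assumes "0 < a"
  shows "stopping_time Filt (hit a)"
proof
  fix t :: ennreal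
  have "{\<omega> \<in> Omega. hit a \<omega> \<le> t} \<in> sets (Filt t)"
  proof (cases t)
    case (real r)
    have "{\<omega> \<in> Omega. hit a \<omega> \<le> ennreal r} \<in> sets (F_raw s)" if "r < s" for s
    proof -
      have "{\<omega> \<in> Omega. hit a \<omega> \<le> ennreal r} =
          (\<Inter>n::nat. {\<omega> \<in> Omega. hit a \<omega> < ennreal (r + (s - r) / real (Suc n))})"
      proof (intro equalityI subsetI)
        fix \<omega> assume "\<omega> \<in> {\<omega> \<in> Omega. hit a \<omega> \<le> ennreal r}"
        moreover have "ennreal r < ennreal (r + (s - r) / real (Suc n))" for n
          using real(1) that by (simp add: ennreal_less_iff)
        ultimately show "\<omega> \<in> (\<Inter>n::nat. {\<omega> \<in> Omega. hit a \<omega> < ennreal (r + (s - r) / real (Suc n))})"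
          by (auto intro: order.strict_trans1)
      next
        fix \<omega> assume *: "\<omega> \<in> (\<Inter>n::nat. {\<omega> \<in> Omega. hit a \<omega> < ennreal (r + (s - r) / real (Suc n))})"
        have "(\<lambda>n. r + (s - r) * (1 / real (Suc n))) \<longlonglongrightarrow> r + (s - r) * 0"
          by (intro tendsto_intros LIMSEQ_Suc[OF lim_1_over_n])
        then have "(\<lambda>n. ennreal (r + (s - r) / real (Suc n))) \<longlonglongrightarrow> ennreal r"
          by (intro tendsto_ennrealI) simp
        then have "hit a \<omega> \<le> ennreal r"
          by (rule LIMSEQ_le_const) (use * in \<open>auto intro: less_imp_le\<close>)
        with * show "\<omega> \<in> {\<omega> \<in> Omega. hit a \<omega> \<le> ennreal r}" by auto
      qed
      also have "\<dots> \<in> sets (F_raw s)"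
      proof (rule sets.countable_INT)
        have "{\<omega> \<in> Omega. hit a \<omega> < ennreal (r + (s - r) / real (Suc n))} \<in> sets (F_raw s)" for n
        proof (rule subsetD[OF sets_F_raw_mono hit_less_measurable[OF assms]])
          have "(s - r) / real (Suc n) \<le> (s - r) / 1"
            using that by (intro divide_left_mono) auto
          then show "r + (s - r) / real (Suc n) \<le> s" by simp
        qed
        then show "range (\<lambda>n. {\<omega> \<in> Omega. hit a \<omega> < ennreal (r + (s - r) / real (Suc n))}) \<subseteq> sets (F_raw s)"
          by auto
      qed simp
      finally show ?thesis .
    qed
    then show ?thesis
      using real by (auto simp: Filt_def sets_F_at)
  next
    case top
    then show ?thesis
      using sets.top[of F_inf] by (simp add: Filt_def)
  qed
  then show "Measurable.pred (Filt t) (\<lambda>\<omega>. hit a \<omega> \<le> t)"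
    by (simp add: pred_def Filt.space_F)
qed

lemma hit_measurable: "0 < a \<Longrightarrow> hit a \<in> borel_measurable F_inf"
  using measurable_stopping_time[OF stopping_time_hit, of a "Filt \<top>"]
    Filt.sets_F_mono[of _ "\<top>"] Filt.space_F by (simp add: Filt_def[of "\<top>"] )

text \<open>
  On paths that never hit \<open>a\<close> this is the path itself, because \<open>enn2real\<close> sends \<open>\<infinity>\<close> to \<open>0\<close>.
\<close>

definition restart :: "real \<Rightarrow> path \<Rightarrow> path" where
  "restart a \<omega> = shift (enn2real (hit a \<omega>)) \<omega>"

lemma restart_measurable:
  assumes "0 < a"
  shows "restart a \<in> measurable F_inf F_inf"
proof -
  have sp: "restart a \<in> space F_inf \<rightarrow> Omega"
    by (auto simp: restart_def shift_Omega)
  have raw: "restart a \<in> measurable F_inf (F_raw s)" for s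
    unfolding F_raw_def
  proof (rule measurable_measure_of[OF F_raw_gen sp])
    fix A assume "A \<in> {{\<omega> \<in> Omega. \<omega> u \<in> B} | u B. 0 \<le> u \<and> u \<le> s \<and> B \<in> sets state_algebra}"
    then obtain u B where A: "A = {\<omega> \<in> Omega. \<omega> u \<in> B}" and u: "0 \<le> u" and B: "B \<in> sets state_algebra"
      by blast
    have "(\<lambda>\<omega>. restart a \<omega> u) \<in> measurable F_inf state_algebra"
    proof (rule measurable_state_algebraI)
      fix \<omega> assume "\<omega> \<in> space F_inf"
      then have "restart a \<omega> \<in> Omega" using sp by auto
      then show "restart a \<omega> u \<in> insert None (Some ` {0<..})"
        using u by (auto simp: Omega_def PiE_iff)
    next
      have "(\<lambda>\<omega>. pos (enn2real (hit a \<omega>) + u) \<omega>) \<in> borel_measurable F_inf"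
        using hit_measurable[OF assms] u by (intro pos_at_random_time_measurable) auto
      then show "(\<lambda>\<omega>. extend0 (\<lambda>x. x) (restart a \<omega> u)) \<in> borel_measurable F_inf"
        using u by (simp add: restart_def shift_def pos_def)
    qed
    from measurable_sets[OF this B]
    show "restart a -` A \<inter> space F_inf \<in> sets F_inf"
      using sp by (auto simp: A Pi_iff vimage_def conj_commute cong: conj_cong elim!: back_subst[of "\<lambda>A. A \<in> sets F_inf"])
  qed
  have "restart a \<in> measurable F_inf (sigma Omega (\<Union>t\<in>{0<..}. sets (F_at t)))"
  proof (rule measurable_measure_of[OF F_inf_Union_subset sp])
    fix A assume "A \<in> (\<Union>t\<in>{0<..}. sets (F_at t))"
    then obtain t where "A \<in> sets (F_at t)" by blast
    then have "A \<in> sets (F_raw (t + 1))"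
      by (simp add: sets_F_at)
    then show "restart a -` A \<inter> space F_inf \<in> sets F_inf"
      using measurable_sets[OF raw] by blast
  qed
  then show ?thesis
    by (simp add: F_inf_def[symmetric])
qed

section \<open>Scale functions of the transforms\<close>

text \<open>
  A function of class \<open>\<C>\<close> is the integral, starting from \<open>0\<close>, of a tail integral of \<open>\<phi>\<close>, and the
  tail integrals lie between \<open>0\<close> and \<open>C = \<integral> \<phi> dm\<close>.
\<close>

lemma class_C_Lipschitz:
  assumes m: "sets m = sets borel_pos" and \<rho>: "\<rho> \<in> class_C m"
  obtains C where "0 < C" "\<And>x. 0 < x \<Longrightarrow> \<rho> x \<le> C * x" "C-lipschitz_on {0<..} \<rho>"
proof -
  have sp: "space m = {0<..}"
    using sets_eq_imp_space_eq[OF m] by (simp add: space_restrict_space)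
  obtain \<phi> where pos: "\<And>x. 0 < x \<Longrightarrow> 0 < \<rho> x" and \<phi>: "\<And>x. 0 < x \<Longrightarrow> 0 \<le> \<phi> x" "integrable m \<phi>"
    and \<rho>_eq: "\<And>x. 0 < x \<Longrightarrow> \<rho> x = (LINT y:{0<..<x}|lborel. (LINT z:{y<..}|m. \<phi> z))"
    using \<rho> unfolding class_C_def by blast
  define g where "g y = (LINT z:{y<..}|m. \<phi> z)" for y
  define C where "C = (LINT z|m. \<phi> z)"
  have g0: "0 \<le> g y" for y
    unfolding g_def set_lebesgue_integral_def using \<phi>(1) sp
    by (intro Bochner_Integration.integral_nonneg) (auto simp: indicator_def)
  have gC: "g y \<le> C" for y
    unfolding g_def C_def set_lebesgue_integral_def using \<phi> sp
    by (intro integral_mono') (auto simp: indicator_def)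
  \<comment> \<open>A non-integrable function has integral \<open>0\<close>, which positivity of \<open>\<rho> x\<close> excludes.\<close>
  have int: "set_integrable lborel {0<..<x} g" if "0 < x" for x
    using \<rho>_eq[OF that] pos[OF that] not_integrable_integral_eq
    by (force simp: set_integrable_def set_lebesgue_integral_def g_def)
  have bound: "0 \<le> (LINT y:{x..<y}|lborel. g y) \<and> (LINT y:{x..<y}|lborel. g y) \<le> C * (y - x)"
    if "0 < x" "x \<le> y" for x y
  proof -
    have i: "set_integrable lborel {x..<y} g"
      using that by (intro set_integrable_subset[OF int[of y]]) auto
    have c: "set_integrable lborel {x..<y} (\<lambda>_. C)"
      by (rule set_integrable_subset[of _ "{x..y}"]) (auto intro!: borel_integrable_atLeastAtMost')
    have "(LINT y:{x..<y}|lborel. g y) \<le> (LINT y:{x..<y}|lborel. C)"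
      by (rule set_integral_mono[OF i c gC])
    also have "\<dots> = C * (y - x)"
      using that by (simp add: set_lebesgue_integral_def)
    finally show ?thesis
      using g0 by (auto simp: set_lebesgue_integral_def intro!: Bochner_Integration.integral_nonneg)
  qed
  have step: "\<rho> y - \<rho> x = (LINT y:{x..<y}|lborel. g y)" if "0 < x" "x \<le> y" for x y
  proof (cases "x = y")
    case False
    have "{0<..<y} = {0<..<x} \<union> {x..<y}" using that by auto
    then have "(LINT y:{0<..<y}|lborel. g y) = (LINT y:{0<..<x}|lborel. g y) + (LINT y:{x..<y}|lborel. g y)"
      using that int[of x] set_integrable_subset[OF int[of y], of "{x..<y}"]
      by (subst \<open>{0<..<y} = _\<close>, intro set_integral_Un) auto
    then show ?thesis
      using \<rho>_eq[of x] \<rho>_eq[of y] that by (simp add: g_def)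
  qed (simp add: set_lebesgue_integral_def)
  have le: "\<rho> x \<le> C * x" if "0 < x" for x
  proof -
    have c: "set_integrable lborel {0<..<x} (\<lambda>_. C)"
      by (rule set_integrable_subset[of _ "{0..x}"]) (auto intro!: borel_integrable_atLeastAtMost')
    have "(LINT y:{0<..<x}|lborel. g y) \<le> (LINT y:{0<..<x}|lborel. C)"
      by (rule set_integral_mono[OF int[OF that] c gC])
    also have "\<dots> = C * x"
      using that by (simp add: set_lebesgue_integral_def)
    finally show ?thesis
      using \<rho>_eq[OF that] by (simp add: g_def)
  qed
  have "0 < C"
    using le[of 1] pos[of 1] by simp
  moreover have "C-lipschitz_on {0<..} \<rho>"
  proof (rule lipschitz_onI)
    fix x y :: real assume xy: "x \<in> {0<..}" "y \<in> {0<..}"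
    have *: "dist (\<rho> x) (\<rho> y) \<le> C * dist x y" if "0 < x" "x \<le> y" for x y
      using bound[OF that] step[OF that] that by (auto simp: dist_real_def)
    show "dist (\<rho> x) (\<rho> y) \<le> C * dist x y"
      using *[of x y] *[of y x] xy by (cases "x \<le> y") (auto simp: dist_commute)
  qed (use \<open>0 < C\<close> in simp)
  ultimately show ?thesis
    using that le by blast
qed

lemma DERIV_h_scale:
  assumes "continuous_on {0<..} \<rho>" "\<And>x. 0 < x \<Longrightarrow> 0 < \<rho> x" "0 < x"
  shows "(h_scale \<rho> has_real_derivative 1 / (\<rho> x)\<^sup>2) (at x)"
proof -
  define a where "a = min x 1 / 2"
  define b where "b = max x 1 + 1"
  have ab: "0 < a" "a < x" "x < b" "a \<le> 1" "1 \<le> b"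
    using assms(3) by (auto simp: a_def b_def min_def)
  have "continuous_on {a..b} (\<lambda>y. 1 / (\<rho> y)\<^sup>2)"
  proof (intro continuous_intros continuous_on_subset[OF assms(1)])
    show "\<forall>y\<in>{a..b}. (\<rho> y)\<^sup>2 \<noteq> 0"
    proof
      fix y assume "y \<in> {a..b}"
      then have "0 < \<rho> y" using ab by (intro assms(2)) auto
      then show "(\<rho> y)\<^sup>2 \<noteq> 0" by simp
    qed
  qed (use ab in auto)
  then have "((\<lambda>u. LBINT y=1..u. 1 / (\<rho> y)\<^sup>2) has_vector_derivative 1 / (\<rho> x)\<^sup>2) (at x within {a..b})"
    using interval_integral_FTC2[of a 1 b "\<lambda>y. 1 / (\<rho> y)\<^sup>2" x] ab by (simp add: one_ereal_def)
  moreover have "at x within {a..b} = at x"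
    using ab by (intro at_within_interior) auto
  ultimately show ?thesis
    by (simp add: has_real_derivative_iff_has_vector_derivative h_scale_def[abs_def])
qed

lemma h_scale_strict_mono:
  assumes "continuous_on {0<..} \<rho>" "\<And>x. 0 < x \<Longrightarrow> 0 < \<rho> x"
  shows "strict_mono_on {0<..} (h_scale \<rho>)"
proof (rule strict_mono_onI)
  fix r s :: real assume rs: "r \<in> {0<..}" "s \<in> {0<..}" "r < s"
  show "h_scale \<rho> r < h_scale \<rho> s"
  proof (rule DERIV_pos_imp_increasing[OF rs(3)])
    fix x assume "r \<le> x" "x \<le> s"
    then have "0 < x" using rs by auto
    with DERIV_h_scale[OF assms, of x] assms(2)[of x]
    show "\<exists>y. (h_scale \<rho> has_real_derivative y) (at x) \<and> 0 < y"
      by (intro exI[of _ "1 / (\<rho> x)\<^sup>2"]) auto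
  qed
qed

text \<open>
  From \<open>\<rho> x \<le> C x\<close> follows \<open>1 / (\<rho> x)\<^sup>2 \<ge> 1 / (C x)\<^sup>2\<close>, whose integral diverges at \<open>0\<close>. Integrating is
  avoided by noting that the sum of the scale function and \<open>1 / (C\<^sup>2 x)\<close> is nondecreasing.
\<close>

lemma h_scale_at_0:
  assumes \<rho>: "continuous_on {0<..} \<rho>" "\<And>x. 0 < x \<Longrightarrow> 0 < \<rho> x"
    and C: "0 < C" "\<And>x. 0 < x \<Longrightarrow> \<rho> x \<le> C * x"
  shows "filterlim (h_scale \<rho>) at_bot (at_right 0)"
proof (rule filterlim_at_bot_mono)
  define D where "D = h_scale \<rho> 1 + 1 / C\<^sup>2"
  have "filterlim (\<lambda>a. - D + (1 / C\<^sup>2) * inverse a) at_top (at_right 0)"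
    using C(1) by (intro filterlim_tendsto_add_at_top[OF tendsto_const]
        filterlim_tendsto_pos_mult_at_top[OF tendsto_const] filterlim_inverse_at_top_right) auto
  then show "filterlim (\<lambda>a. D - (1 / C\<^sup>2) * inverse a) at_bot (at_right 0)"
    by (simp add: filterlim_uminus_at_bot algebra_simps)
  have "h_scale \<rho> a \<le> D - (1 / C\<^sup>2) * inverse a" if a: "0 < a" "a < 1" for a
  proof -
    have "h_scale \<rho> a + (1 / C\<^sup>2) * inverse a \<le> h_scale \<rho> 1 + (1 / C\<^sup>2) * inverse 1"
    proof (rule DERIV_nonneg_imp_nondecreasing[of a 1])
      fix x assume x: "a \<le> x" "x \<le> 1"
      then have x0: "0 < x" using a by simp
      have "((\<lambda>x. h_scale \<rho> x + (1 / C\<^sup>2) * inverse x) has_real_derivative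
          1 / (\<rho> x)\<^sup>2 + (1 / C\<^sup>2) * (- (inverse x ^ 2))) (at x)"
        using x0 C(1) by (auto intro!: derivative_eq_intros DERIV_h_scale[OF \<rho>] simp: power2_eq_square)
      moreover have "1 / (C * x)\<^sup>2 \<le> 1 / (\<rho> x)\<^sup>2"
      proof (rule divide_left_mono)
        show "(\<rho> x)\<^sup>2 \<le> (C * x)\<^sup>2"
          using \<rho>(2)[OF x0] C(2)[OF x0] by (intro power_mono) auto
        have "0 < C * x" using x0 C(1) by simp
        then show "0 < (C * x)\<^sup>2 * (\<rho> x)\<^sup>2"
          using \<rho>(2)[OF x0] by (metis mult_pos_pos zero_less_power)
      qed simp
      ultimately show "\<exists>y. ((\<lambda>x. h_scale \<rho> x + (1 / C\<^sup>2) * inverse x) has_real_derivative y) (at x) \<and> 0 \<le> y"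
        by (auto simp: field_simps)
    qed (use a in simp)
    then show ?thesis by (simp add: D_def)
  qed
  then show "eventually (\<lambda>a. h_scale \<rho> a \<le> D - (1 / C\<^sup>2) * inverse a) (at_right 0)"
    unfolding eventually_at_right_field by (intro exI[of _ 1]) auto
qed

lemma mono_at_top_or_bounded:
  fixes s :: "real \<Rightarrow> real"
  assumes "mono_on {c<..} s"
  shows "filterlim s at_top at_top \<or> (\<exists>K. \<forall>x>c. s x \<le> K)"
proof (rule disjCI)
  assume n: "\<nexists>K. \<forall>x>c. s x \<le> K"
  show "filterlim s at_top at_top"
    unfolding filterlim_at_top
  proof
    fix K
    from n obtain x where "c < x" "K < s x"
      by (auto simp: not_le)
    then have "K \<le> s y" if "x \<le> y" for y
      using mono_onD[OF assms, of x y] that by auto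
    then show "eventually (\<lambda>y. K \<le> s y) at_top"
      by (auto simp: eventually_at_top_linorder)
  qed
qed

text \<open>
  A bounded increasing scale function would converge, and the integral of its derivative would be
  finite.
\<close>

lemma h_scale_at_top:
  assumes \<rho>: "continuous_on {0<..} \<rho>" "\<And>x. 0 < x \<Longrightarrow> 0 < \<rho> x"
    and inf: "(\<integral>\<^sup>+ x \<in> {1<..}. ennreal (1 / (\<rho> x)\<^sup>2) \<partial>lborel) = \<infinity>"
  shows "filterlim (h_scale \<rho>) at_top at_top"
proof (rule ccontr)
  assume not: "\<not> ?thesis"
  have mono: "mono_on {0<..} (h_scale \<rho>)"
    using h_scale_strict_mono[OF \<rho>] by (rule strict_mono_on_imp_mono_on)
  obtain K where K: "\<And>x. 0 < x \<Longrightarrow> h_scale \<rho> x \<le> K"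
    using mono_at_top_or_bounded[OF mono] not by auto
  define T where "T = (SUP x\<in>{0<..}. h_scale \<rho> x)"
  have bdd: "bdd_above (h_scale \<rho> ` {0<..})"
    using K by (auto intro!: bdd_aboveI)
  have lim: "(h_scale \<rho> \<longlongrightarrow> T) at_top"
  proof (rule increasing_tendsto)
    show "eventually (\<lambda>x. h_scale \<rho> x \<le> T) at_top"
      using eventually_gt_at_top[of 0] by eventually_elim (auto simp: T_def intro!: cSUP_upper bdd)
    fix y assume "y < T"
    then obtain x where x: "0 < x" "y < h_scale \<rho> x"
      unfolding T_def by (subst (asm) less_cSUP_iff[OF _ bdd]) auto
    show "eventually (\<lambda>z. y < h_scale \<rho> z) at_top"
      using eventually_ge_at_top[of x]
      by eventually_elim (use x mono_onD[OF mono, of x] in force)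
  qed
  \<comment> \<open>\<open>\<rho>\<close> is only controlled on the half line; the cut-off makes the derivative of the scale function Borel on the whole line.\<close>
  define f where "f x = indicator {0<..} x * (1 / (\<rho> x)\<^sup>2)" for x
  have "f \<in> borel_measurable borel"
  proof -
    have "continuous_on {0<..} (\<lambda>x. 1 / (\<rho> x)\<^sup>2)"
      using \<rho> by (intro continuous_intros) (auto simp: less_imp_neq[symmetric])
    then show ?thesis
      unfolding f_def using borel_measurable_continuous_on_indicator[of "{0<..}" "\<lambda>x. 1 / (\<rho> x)\<^sup>2"] by simp
  qed
  then have "(\<integral>\<^sup>+x. ennreal (f x) * indicator {1..} x \<partial>lborel) = ennreal (T - h_scale \<rho> 1)"
    by (rule nn_integral_FTC_atLeast) (use DERIV_h_scale[OF \<rho>] lim in \<open>auto simp: f_def indicator_def\<close>)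
  moreover have "(\<integral>\<^sup>+ x \<in> {1<..}. ennreal (1 / (\<rho> x)\<^sup>2) \<partial>lborel) \<le> (\<integral>\<^sup>+x. ennreal (f x) * indicator {1..} x \<partial>lborel)"
    by (intro nn_integral_mono) (auto simp: f_def indicator_def)
  ultimately show False
    using inf by (simp add: top_unique)
qed

text \<open>
  If all exit probabilities from \<open>x\<close> agreed, the increments of the two scale functions to the right
  and to the left of \<open>x\<close> would be proportional, all with one and the same factor \<open>c\<close>. The scale
  functions would be affinely related, and comparing derivatives would give \<open>\<beta> = sqrt c * \<alpha>\<close>.
\<close>

lemma exit_ratio_differs:
  assumes \<alpha>: "continuous_on {0<..} \<alpha>" "\<And>x. 0 < x \<Longrightarrow> 0 < \<alpha> x"
    and \<beta>: "continuous_on {0<..} \<beta>" "\<And>x. 0 < x \<Longrightarrow> 0 < \<beta> x"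
    and ne: "\<not> (\<exists>c. \<forall>x>0. \<alpha> x = c * \<beta> x)" and x: "0 < x"
  obtains (wit) a b where "0 < a" "a < x" "x < b"
    "(h_scale \<alpha> b - h_scale \<alpha> x) / (h_scale \<alpha> b - h_scale \<alpha> a) \<noteq>
     (h_scale \<beta> b - h_scale \<beta> x) / (h_scale \<beta> b - h_scale \<beta> a)"
proof (rule ccontr)
  let ?s = "h_scale \<alpha>" and ?r = "h_scale \<beta>"
  note s_mono = strict_mono_onD[OF h_scale_strict_mono[OF \<alpha>]]
  note r_mono = strict_mono_onD[OF h_scale_strict_mono[OF \<beta>]]
  assume not_thesis: "\<not> thesis"
  have eq: "(?s b - ?s x) / (?s b - ?s a) = (?r b - ?r x) / (?r b - ?r a)"
    if "0 < a" "a < x" "x < b" for a b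
    using that not_thesis wit by blast
  have cross: "(?s b - ?s x) * (?r x - ?r a) = (?s x - ?s a) * (?r b - ?r x)"
    if "0 < a" "a < x" "x < b" for a b
  proof -
    have "0 < ?s b - ?s a" "0 < ?r b - ?r a"
      using s_mono[of a b] r_mono[of a b] that by auto
    with eq[OF that] have "(?s b - ?s x) * (?r b - ?r a) = (?r b - ?r x) * (?s b - ?s a)"
      by (simp add: frac_eq_eq)
    then show ?thesis by (simp add: algebra_simps)
  qed
  define c where "c = (?s x - ?s (x / 2)) / (?r x - ?r (x / 2))"
  have c_num: "0 < ?s x - ?s (x / 2)" "0 < ?r x - ?r (x / 2)"
    using s_mono[of "x / 2" x] r_mono[of "x / 2" x] x by auto
  then have c: "0 < c" by (simp add: c_def)
  have up: "?s y - ?s x = c * (?r y - ?r x)" if "x < y" for y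
    using cross[of "x / 2" y] x that c_num by (simp add: c_def field_simps)
  have aff: "?s y = c * ?r y + (?s x - c * ?r x)" if "0 < y" for y
  proof (rule linorder_cases[of y x])
    assume "y < x"
    have "0 < ?r (x + 1) - ?r x"
      using r_mono[of x "x + 1"] x by auto
    moreover have "c * (?r x - ?r y) * (?r (x + 1) - ?r x) = (?s x - ?s y) * (?r (x + 1) - ?r x)"
      using cross[of y "x + 1"] up[of "x + 1"] \<open>y < x\<close> that by (simp add: mult_ac)
    ultimately have "c * (?r x - ?r y) = ?s x - ?s y" by simp
    then show ?thesis by (simp add: algebra_simps)
  next
    assume "x < y"
    with up[of y] show ?thesis by (simp add: algebra_simps)
  qed simp
  have "\<alpha> y = (1 / sqrt c) * \<beta> y" if y: "0 < y" for y
  proof -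
    have "((\<lambda>y. c * ?r y + (?s x - c * ?r x)) has_real_derivative c * (1 / (\<beta> y)\<^sup>2)) (at y)"
      by (auto intro!: derivative_eq_intros DERIV_h_scale[OF \<beta>] y)
    then have "(?s has_real_derivative c * (1 / (\<beta> y)\<^sup>2)) (at y)"
      using y aff by (rule_tac has_field_derivative_transform_within_open[of _ _ _ "{0<..}"]) auto
    from DERIV_unique[OF DERIV_h_scale[OF \<alpha> y] this]
    have "(\<beta> y)\<^sup>2 = (sqrt c * \<alpha> y)\<^sup>2"
      using c \<alpha>(2)[OF y] \<beta>(2)[OF y] by (simp add: field_simps power_mult_distrib)
    then have "\<beta> y = sqrt c * \<alpha> y"
      using c \<alpha>(2)[OF y] \<beta>(2)[OF y] by (subst (asm) power2_eq_iff_nonneg) auto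
    then show ?thesis using c by simp
  qed
  then show False using ne by blast
qed

section \<open>Singularity from approximate separation\<close>

text \<open>
  Separating sets \<open>B k\<close> with errors \<open>(1/2) ^ k\<close> have summable errors, so by Borel--Cantelli their
  limes superior separates exactly.
\<close>

lemma singular_on_approx:
  assumes \<mu>: "sets \<mu> = sets G" and \<nu>: "sets \<nu> = sets G"
    and ex: "\<And>e::real. 0 < e \<Longrightarrow> \<exists>B\<in>sets G. emeasure \<mu> B < ennreal e \<and> emeasure \<nu> (space G - B) < ennreal e"
  shows "singular_on G \<mu> \<nu>"
proof -
  have "\<forall>k::nat. \<exists>B\<in>sets G. emeasure \<mu> B < ennreal ((1/2)^k) \<and> emeasure \<nu> (space G - B) < ennreal ((1/2)^k)"
    by (intro allI ex) simp
  then obtain B where B: "\<And>k::nat. B k \<in> sets G" "\<And>k. emeasure \<mu> (B k) < ennreal ((1/2)^k)"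
      "\<And>k. emeasure \<nu> (space G - B k) < ennreal ((1/2)^k)"
    by metis
  have null: "limsup D \<in> null_sets M"
    if "\<And>k. D k \<in> sets M" "\<And>k. emeasure M (D k) < ennreal ((1/2)^k)" for M and D :: "nat \<Rightarrow> 'a set"
  proof (rule borel_cantelli_limsup1[OF that(1)])
    show fin: "emeasure M (D k) < \<infinity>" for k
      using that(2)[of k] order.strict_trans[OF _ ennreal_less_top] by (simp add: infinity_ennreal_def)
    have "measure M (D k) \<le> (1/2)^k" for k
      using that(2)[of k] fin[of k] unfolding measure_def
      by (intro enn2real_leI) (auto intro: less_imp_le)
    then show "summable (\<lambda>k. measure M (D k))"
      by (intro summable_comparison_test'[OF summable_geometric[of "1/2::real"]]) auto
  qed
  define A where "A = limsup B"
  have "A \<in> sets G"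
    unfolding A_def limsup_INF_SUP using B(1) by auto
  moreover have "emeasure \<mu> A = 0"
    using null[of B \<mu>] B \<mu> by (auto simp: A_def)
  moreover have "emeasure \<nu> (space G - A) = 0"
  proof -
    have n: "limsup (\<lambda>k. space G - B k) \<in> null_sets \<nu>"
      using B \<nu> by (intro null) auto
    have "space G - A \<subseteq> limsup (\<lambda>k. space G - B k)"
    proof
      fix \<omega> assume \<omega>: "\<omega> \<in> space G - A"
      then obtain n where n: "\<And>k. n \<le> k \<Longrightarrow> \<omega> \<notin> B k"
        unfolding A_def limsup_INF_SUP by auto
      have "\<exists>k\<ge>i. \<omega> \<notin> B k" for i
        using n[of "max i n"] by (intro exI[of _ "max i n"]) auto
      with \<omega> show "\<omega> \<in> limsup (\<lambda>k. space G - B k)"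
        unfolding limsup_INF_SUP by auto
    qed
    from emeasure_mono[OF this null_setsD2[OF n]] null_setsD1[OF n] show ?thesis
      by simp
  qed
  ultimately show ?thesis
    by (auto simp: singular_on_def)
qed

section \<open>The strong Markov property at hitting times\<close>

lemma diffusion_prob_space:
  assumes "diffusion s m P" "0 < x"
  shows "prob_space (P x)" "sets (P x) = sets F_inf" "space (P x) = Omega"
proof -
  have "P x \<in> space (prob_algebra F_inf)"
    using assms unfolding diffusion_def
    by (intro measurable_space[of P borel_pos]) (auto simp: space_restrict_space)
  then show "prob_space (P x)" and *: "sets (P x) = sets F_inf"
    by (auto simp: space_prob_algebra)
  show "space (P x) = Omega"
    using sets_eq_imp_space_eq[OF *] by simp
qed

lemma diffusion_exit:
  assumes "diffusion s m P" "0 < a" "a < x" "x < b"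
  shows "measure (P x) {\<omega> \<in> Omega. hit a \<omega> < hit b \<omega>} = (s b - s x) / (s b - s a)"
    "measure (P x) {\<omega> \<in> Omega. hit b \<omega> < hit a \<omega>} = (s x - s a) / (s b - s a)"
  using assms unfolding diffusion_def by blast+

lemma pre_sigma_hit_F_inf:
  assumes "0 < a" "A \<in> sets (Filt.pre_sigma (hit a))"
  shows "A \<in> sets F_inf"
  using Filt.sets_pre_sigmaD[OF stopping_time_hit[OF assms(1)] assms(2), of \<top>] by (simp add: Filt_def)

lemma restart_Omega: "\<omega> \<in> Omega \<Longrightarrow> restart a \<omega> \<in> Omega"
  by (simp add: restart_def shift_Omega)

text \<open>
  At a hitting time the position is known, so the restarted path is independent of the past and
  distributed as the diffusion started from the level.
\<close>

lemma strong_Markov_hit: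
  assumes P: "diffusion s m P" and x: "0 < x" and z: "0 < z"
    and fin: "AE \<omega> in P x. hit z \<omega> < \<top>"
    and A: "A \<in> sets (Filt.pre_sigma (hit z))" and B: "B \<in> sets F_inf"
  shows "emeasure (P x) (A \<inter> restart z -` B) = emeasure (P x) A * emeasure (P z) B"
proof -
  note Px = diffusion_prob_space[OF P x]
  have AF: "A \<in> sets F_inf" by (rule pre_sigma_hit_F_inf[OF z A])
  then have AO: "A \<subseteq> Omega" using sets.sets_into_space[of A F_inf] by simp
  have alive: "hit z \<omega> < lifetime \<omega> \<longleftrightarrow> hit z \<omega> < \<top>" if "\<omega> \<in> Omega" for \<omega>
    using hit_less_lifetime[OF that z] by (auto intro: order.strict_trans2)
  have [measurable]: "hit z \<in> borel_measurable F_inf" "A \<in> sets F_inf"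
    using hit_measurable[OF z] AF by auto
  have RB: "restart z -` B \<inter> Omega \<in> sets F_inf"
    using measurable_sets[OF restart_measurable[OF z] B] by simp
  have AR: "A \<inter> restart z -` B \<in> sets F_inf"
  proof -
    have "A \<inter> restart z -` B = A \<inter> (restart z -` B \<inter> Omega)" using AO by auto
    then show ?thesis using sets.Int[OF AF RB] by simp
  qed
  have "A \<inter> restart z -` B \<inter> {\<omega> \<in> Omega. hit z \<omega> < \<top>} \<in> sets F_inf"
  proof (rule sets.Int[OF AR])
    show "{\<omega> \<in> Omega. hit z \<omega> < \<top>} \<in> sets F_inf"
      using borel_measurable_less[OF hit_measurable[OF z] borel_measurable_const[of \<top>]] by simp
  qed
  also have "A \<inter> restart z -` B \<inter> {\<omega> \<in> Omega. hit z \<omega> < \<top>} =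
     {\<omega> \<in> A. hit z \<omega> < lifetime \<omega> \<and> shift (enn2real (hit z \<omega>)) \<omega> \<in> B}" (is "_ = ?L")
    using AO alive by (auto simp: restart_def)
  finally have L: "?L \<in> sets F_inf" .
  have "emeasure (P x) (A \<inter> restart z -` B) = emeasure (P x) ?L"
  proof (rule emeasure_eq_AE)
    show "AE \<omega> in P x. \<omega> \<in> A \<inter> restart z -` B \<longleftrightarrow> \<omega> \<in> ?L"
      using fin by eventually_elim (use AO alive in \<open>auto simp: restart_def\<close>)
  qed (use AR L Px in auto)
  also have "\<dots> = (\<integral>\<^sup>+ \<omega> \<in> {\<omega> \<in> A. hit z \<omega> < lifetime \<omega>}.
             emeasure (P (the (\<omega> (enn2real (hit z \<omega>))))) B \<partial>P x)"
    using P x A B stopping_time_hit[OF z] unfolding diffusion_def strong_Markov_def by blast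
  also have "\<dots> = (\<integral>\<^sup>+ \<omega>. emeasure (P z) B * indicator A \<omega> \<partial>P x)"
  proof (rule nn_integral_cong_AE)
    show "AE \<omega> in P x. emeasure (P (the (\<omega> (enn2real (hit z \<omega>))))) B * indicator {\<omega> \<in> A. hit z \<omega> < lifetime \<omega>} \<omega>
        = emeasure (P z) B * indicator A \<omega>"
      using fin AE_space
    proof eventually_elim
      case (elim \<omega>)
      then have "\<omega> \<in> Omega" using Px by simp
      with elim show ?case
        using path_at_hit[of \<omega> z] hit_less_lifetime[of \<omega> z] z by (auto simp: indicator_def)
    qed
  qed
  also have "\<dots> = emeasure (P z) B * emeasure (P x) A"
    using AF Px by (subst nn_integral_cmult_indicator) auto
  finally show ?thesis by (simp add: mult.commute)
qed

section \<open>Recurrence and transience\<close>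

lemma hit_less_sets: "0 < a \<Longrightarrow> 0 < b \<Longrightarrow> {\<omega> \<in> Omega. hit a \<omega> < hit b \<omega>} \<in> sets F_inf"
  using borel_measurable_less[OF hit_measurable hit_measurable, of a b] by simp

lemma hit_less_top_sets: "0 < a \<Longrightarrow> {\<omega> \<in> Omega. hit a \<omega> < \<top>} \<in> sets F_inf"
  using borel_measurable_less[OF hit_measurable[of a] borel_measurable_const[of \<top>]] by simp

text \<open>
  The level \<open>a\<close> is hit at least as likely as it is hit before \<open>b\<close>. The latter probability tends to
  \<open>1\<close> when \<open>b\<close> is moved away from \<open>a\<close>, beyond \<open>x\<close>, to the boundary, where the scale function is infinite.
\<close>

lemma recurrent_hits:
  assumes P: "diffusion s m P" and mono: "strict_mono_on {0<..} s"
    and top: "filterlim s at_top at_top" and bot: "filterlim s at_bot (at_right 0)"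
    and xa: "0 < x" "0 < a" "x \<noteq> a"
  shows "AE \<omega> in P x. hit a \<omega> < \<top>"
proof -
  interpret prob_space "P x" by (rule diffusion_prob_space[OF P xa(1)])
  note Px = diffusion_prob_space[OF P xa(1)]
  have le: "prob {\<omega> \<in> Omega. hit a \<omega> < hit b \<omega>} \<le> prob {\<omega> \<in> Omega. hit a \<omega> < \<top>}" if "0 < b" for b
    using hit_less_top_sets[OF xa(2)] Px
    by (intro finite_measure_mono) (auto intro: order.strict_trans2)
  have "1 \<le> prob {\<omega> \<in> Omega. hit a \<omega> < \<top>}"
  proof (rule linorder_cases[of a x])
    assume ax: "a < x"
    have "((\<lambda>b. 1 - (s x - s a) / (s b - s a)) \<longlongrightarrow> 1 - 0) at_top"
    proof (intro tendsto_diff tendsto_const tendsto_divide_0[OF tendsto_const])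
      have "filterlim (\<lambda>b. - s a + s b) at_top at_top"
        by (rule filterlim_tendsto_add_at_top[OF tendsto_const top])
      then show "filterlim (\<lambda>b. s b - s a) at_infinity at_top"
        by (intro filterlim_at_top_imp_at_infinity) simp
    qed
    moreover have "eventually (\<lambda>b. 1 - (s x - s a) / (s b - s a) \<le> prob {\<omega> \<in> Omega. hit a \<omega> < \<top>}) at_top"
      using eventually_gt_at_top[of x]
    proof eventually_elim
      case (elim b)
      have "s a < s b" using strict_mono_onD[OF mono, of a b] xa ax elim by auto
      then have "1 - (s x - s a) / (s b - s a) = prob {\<omega> \<in> Omega. hit a \<omega> < hit b \<omega>}"
        using diffusion_exit(1)[OF P xa(2) ax elim] by (simp add: field_simps)
      also have "\<dots> \<le> prob {\<omega> \<in> Omega. hit a \<omega> < \<top>}"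
        using xa elim by (intro le) auto
      finally show ?case .
    qed
    ultimately show ?thesis
      by (intro tendsto_upperbound[of _ 1 at_top]) auto
  next
    assume xa': "x < a"
    have "((\<lambda>b. 1 - (s a - s x) / (s a - s b)) \<longlongrightarrow> 1 - 0) (at_right 0)"
    proof (intro tendsto_diff tendsto_const tendsto_divide_0[OF tendsto_const])
      have "filterlim (\<lambda>b. s a + - s b) at_top (at_right 0)"
        using bot by (intro filterlim_tendsto_add_at_top[OF tendsto_const]) (simp add: filterlim_uminus_at_top)
      then show "filterlim (\<lambda>b. s a - s b) at_infinity (at_right 0)"
        by (intro filterlim_at_top_imp_at_infinity) simp
    qed
    moreover have "eventually (\<lambda>b. 1 - (s a - s x) / (s a - s b) \<le> prob {\<omega> \<in> Omega. hit a \<omega> < \<top>}) (at_right 0)"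
      using eventually_at_right_less[of 0] eventually_at_right_real[OF xa(1)]
    proof eventually_elim
      case (elim b)
      then have b: "0 < b" "b < x" by auto
      have "s b < s a" using strict_mono_onD[OF mono, of b a] b xa' by auto
      then have "1 - (s a - s x) / (s a - s b) = prob {\<omega> \<in> Omega. hit a \<omega> < hit b \<omega>}"
        using diffusion_exit(2)[OF P b xa'] by (simp add: field_simps)
      also have "\<dots> \<le> prob {\<omega> \<in> Omega. hit a \<omega> < \<top>}"
        using b by (intro le) auto
      finally show ?case .
    qed
    ultimately show ?thesis
      by (intro tendsto_upperbound[of _ 1 "at_right 0"]) auto
  qed (use xa in simp)
  then have "prob {\<omega> \<in> Omega. hit a \<omega> < \<top>} = 1"
    using prob_le_1 by (intro antisym) auto
  then have "AE \<omega> in P x. \<omega> \<in> {\<omega> \<in> Omega. hit a \<omega> < \<top>}"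
    by (rule AE_prob_1)
  then show ?thesis by eventually_elim auto
qed

text \<open>
  Until it hits \<open>a\<close> the path is continuous on a compact time interval, hence bounded.
\<close>

lemma eventually_hit_before:
  assumes \<omega>: "\<omega> \<in> Omega" and a: "0 < a" and fin: "hit a \<omega> < \<top>"
  obtains M where "\<And>b. M < b \<Longrightarrow> hit a \<omega> < hit b \<omega>"
proof -
  define \<tau> where "\<tau> = enn2real (hit a \<omega>)"
  have \<tau>: "hit a \<omega> = ennreal \<tau>" "0 \<le> \<tau>" "pos \<tau> \<omega> = a"
    using fin hit_attained[OF \<omega> a fin] by (auto simp: \<tau>_def less_top)
  have "ennreal s < lifetime \<omega>" if "0 \<le> s" "s \<le> \<tau>" for s
    using that alive_before[OF \<omega>, of s \<tau>] a \<tau>(3) pos_gt_0_iff_alive[OF \<omega>, of s] by auto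
  then have "continuous_on {0..\<tau>} (\<lambda>s. pos s \<omega>)"
    by (intro continuous_on_subset[OF continuous_on_pos[OF \<omega>]]) auto
  then have "compact ((\<lambda>s. pos s \<omega>) ` {0..\<tau>})"
    by (rule compact_continuous_image) simp
  then obtain M where M: "\<And>s. 0 \<le> s \<Longrightarrow> s \<le> \<tau> \<Longrightarrow> \<bar>pos s \<omega>\<bar> \<le> M"
    using compact_imp_bounded bounded_iff by (metis (no_types, lifting) atLeastAtMost_iff image_eqI real_norm_def)
  show thesis
  proof (rule that[of M], rule ccontr)
    fix b assume b: "M < b" and "\<not> hit a \<omega> < hit b \<omega>"
    then have le: "hit b \<omega> \<le> ennreal \<tau>" using \<tau> by simp
    have b0: "0 < b" using M[of 0] \<tau>(2) b by auto
    have "hit b \<omega> < \<top>" using le by (auto intro: order.strict_trans1)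
    then have "pos (enn2real (hit b \<omega>)) \<omega> = b"
      by (rule hit_attained[OF \<omega> b0])
    moreover have "enn2real (hit b \<omega>) \<le> \<tau>"
      using le \<tau>(2) by (rule enn2real_leI[rotated])
    ultimately show False
      using M[of "enn2real (hit b \<omega>)"] b by simp
  qed
qed

text \<open>
  The probability of hitting \<open>a\<close> before \<open>b\<close> obeys this bound uniformly in \<open>b\<close>, and a path that hits \<open>a\<close>
  does so before it reaches any sufficiently high level.
\<close>

lemma transient_hit_bound:
  assumes P: "diffusion s m P" and mono: "strict_mono_on {0<..} s"
    and K: "\<And>y. 0 < y \<Longrightarrow> s y \<le> K" and ax: "0 < a" "a < x"
  shows "emeasure (P x) {\<omega> \<in> Omega. hit a \<omega> < \<top>} \<le> ennreal ((K - s x) / (K - s a))"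
proof -
  have x: "0 < x" using ax by simp
  interpret prob_space "P x" by (rule diffusion_prob_space[OF P x])
  note Px = diffusion_prob_space[OF P x]
  define H where "H k = {\<omega> \<in> Omega. hit a \<omega> < hit (x + real (Suc k)) \<omega>}" for k
  \<comment> \<open>The events \<open>H k\<close> themselves need not increase pathwise, since a path need not start from \<open>x\<close>.\<close>
  define G where "G n = (\<Inter>k\<in>{n..}. H k)" for n
  have Hs: "H k \<in> sets (P x)" for k
    using hit_less_sets[of a "x + real (Suc k)"] ax Px by (simp add: H_def)
  then have Gs: "G n \<in> sets (P x)" for n
    unfolding G_def by (intro sets.countable_INT') auto
  have "{\<omega> \<in> Omega. hit a \<omega> < \<top>} \<subseteq> (\<Union>n. G n)"
  proof
    fix \<omega> assume "\<omega> \<in> {\<omega> \<in> Omega. hit a \<omega> < \<top>}"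
    then have \<omega>: "\<omega> \<in> Omega" "hit a \<omega> < \<top>" by auto
    then obtain M where M: "\<And>b. M < b \<Longrightarrow> hit a \<omega> < hit b \<omega>"
      using eventually_hit_before[OF _ ax(1)] by blast
    obtain n :: nat where "M < real n" using reals_Archimedean2 by blast
    then have "M < x + real (Suc k)" if "n \<le> k" for k using that x by simp
    then have "\<omega> \<in> G n" using M \<omega> by (auto simp: G_def H_def)
    then show "\<omega> \<in> (\<Union>n. G n)" by blast
  qed
  then have "emeasure (P x) {\<omega> \<in> Omega. hit a \<omega> < \<top>} \<le> emeasure (P x) (\<Union>n. G n)"
    using Gs by (intro emeasure_mono) auto
  also have "\<dots> = (SUP n. emeasure (P x) (G n))"
    using Gs by (intro SUP_emeasure_incseq[symmetric]) (auto simp: G_def incseq_def)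
  also have "\<dots> \<le> ennreal ((K - s x) / (K - s a))"
  proof (rule SUP_least)
    fix n
    define b where "b = x + real (Suc n)"
    have b: "x < b" by (simp add: b_def)
    have s: "s a < s x" "s x < s b" "s b \<le> K"
      using strict_mono_onD[OF mono, of a x] strict_mono_onD[OF mono, of x b] K[of b] ax b x by auto
    have "(s b - s x) / (s b - s a) = 1 - (s x - s a) / (s b - s a)"
      using s by (simp add: field_simps)
    also have "\<dots> \<le> 1 - (s x - s a) / (K - s a)"
      using s by (intro diff_left_mono divide_left_mono mult_pos_pos) auto
    also have "\<dots> = (K - s x) / (K - s a)"
      using s by (simp add: field_simps)
    finally have *: "(s b - s x) / (s b - s a) \<le> (K - s x) / (K - s a)" .
    have "emeasure (P x) (G n) \<le> emeasure (P x) (H n)"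
      using Hs by (intro emeasure_mono) (auto simp: G_def)
    also have "\<dots> = ennreal ((s b - s x) / (s b - s a))"
      using diffusion_exit(1)[OF P ax b] by (simp add: emeasure_eq_measure H_def b_def)
    finally show "emeasure (P x) (G n) \<le> ennreal ((K - s x) / (K - s a))"
      using * by (meson ennreal_leI order.trans)
  qed
  finally show ?thesis .
qed

text \<open>
  The event that a level \<open>a\<close> close to \<open>0\<close> is never hit has probability \<open>0\<close> under the recurrent law and
  probability close to \<open>1\<close> under the transient one.
\<close>

lemma recurrent_transient_singular:
  assumes P: "diffusion s m P" and mono: "strict_mono_on {0<..} s"
    and top: "filterlim s at_top at_top" and bot: "filterlim s at_bot (at_right 0)"
    and Q: "diffusion r n Q" and rmono: "strict_mono_on {0<..} r"
    and rbdd: "\<And>y. 0 < y \<Longrightarrow> r y \<le> K" and rbot: "filterlim r at_bot (at_right 0)"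
    and x: "0 < x"
  shows "singular_on F_inf (P x) (Q x)"
proof (rule singular_on_approx)
  fix e :: real assume e: "0 < e"
  have "((\<lambda>a. (K - r x) / (K - r a)) \<longlongrightarrow> 0) (at_right 0)"
  proof (rule tendsto_divide_0[OF tendsto_const])
    have "filterlim (\<lambda>b. K + - r b) at_top (at_right 0)"
      using rbot by (intro filterlim_tendsto_add_at_top[OF tendsto_const]) (simp add: filterlim_uminus_at_top)
    then show "filterlim (\<lambda>b. K - r b) at_infinity (at_right 0)"
      by (intro filterlim_at_top_imp_at_infinity) simp
  qed
  from order_tendstoD(2)[OF this e] eventually_at_right_less[of 0] eventually_at_right_real[OF x]
  have "eventually (\<lambda>a. 0 < a \<and> a < x \<and> (K - r x) / (K - r a) < e) (at_right 0)"
    by eventually_elim auto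
  then obtain a where a: "0 < a" "a < x" "(K - r x) / (K - r a) < e"
    using eventually_happens'[OF trivial_limit_at_right_real] by blast
  let ?B = "{\<omega> \<in> Omega. \<not> hit a \<omega> < \<top>}"
  have B: "Omega - ?B = {\<omega> \<in> Omega. hit a \<omega> < \<top>}" "?B = space F_inf - {\<omega> \<in> Omega. hit a \<omega> < \<top>}"
    by auto
  have Bs: "?B \<in> sets F_inf"
    unfolding B(2) using hit_less_top_sets[OF a(1)] by (rule sets.compl_sets)
  have "AE \<omega> in P x. hit a \<omega> < \<top>"
    using a x by (intro recurrent_hits[OF P mono top bot]) auto
  then have "emeasure (P x) ?B = 0"
    using AE_iff_measurable[of ?B "P x" "\<lambda>\<omega>. hit a \<omega> < \<top>"] Bs diffusion_prob_space[OF P x] by simp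
  moreover have "emeasure (Q x) (space F_inf - ?B) < ennreal e"
  proof -
    have "emeasure (Q x) (space F_inf - ?B) \<le> ennreal ((K - r x) / (K - r a))"
      unfolding space_F_inf B(1) by (rule transient_hit_bound[OF Q rmono rbdd a(1,2)])
    also have "\<dots> < ennreal e"
      using e a(3) by (rule ennreal_lessI)
    finally show ?thesis .
  qed
  ultimately show "\<exists>B\<in>sets F_inf. emeasure (P x) B < ennreal e \<and> emeasure (Q x) (space F_inf - B) < ennreal e"
    using e by (intro bexI[OF _ Bs] conjI) simp_all
qed (use diffusion_prob_space[OF P x] diffusion_prob_space[OF Q x] in auto)

section \<open>Independent cycles\<close>

definition cycle :: "real \<Rightarrow> real \<Rightarrow> path \<Rightarrow> path" where
  "cycle x a = restart x \<circ> restart a"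

lemma cycle_measurable: "0 < x \<Longrightarrow> 0 < a \<Longrightarrow> cycle x a \<in> measurable F_inf F_inf"
  unfolding cycle_def by (intro measurable_comp[of _ _ F_inf] restart_measurable)

text \<open>
  The strong Markov property is used twice, at the visit to \<open>a\<close> and at the return to \<open>x\<close>. Hence
  what happens after a cycle is independent of what happens before the visit to \<open>a\<close>, and the
  cycle map preserves the law of the diffusion started from \<open>x\<close>.
\<close>

lemma emeasure_cycle:
  assumes P: "diffusion s m P" and x: "0 < x" and a: "0 < a"
    and fin: "AE \<omega> in P x. hit a \<omega> < \<top>" "AE \<omega> in P a. hit x \<omega> < \<top>"
    and E: "E \<in> sets (Filt.pre_sigma (hit a))" and B: "B \<in> sets F_inf"
  shows "emeasure (P x) (E \<inter> cycle x a -` B) = emeasure (P x) E * emeasure (P x) B"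
proof -
  let ?C = "Omega \<inter> restart x -` B"
  have EO: "E \<subseteq> Omega"
    using sets.sets_into_space[OF E] by (simp add: Filt.space_pre_sigma)
  have C: "?C \<in> sets F_inf"
    using measurable_sets[OF restart_measurable[OF x] B] by (simp add: Int_commute)
  have O: "Omega \<in> sets (Filt.pre_sigma (hit x))"
    using sets.top[of "Filt.pre_sigma (hit x)"] by (simp add: Filt.space_pre_sigma)
  have "E \<inter> cycle x a -` B = E \<inter> restart a -` ?C"
    using EO restart_Omega by (auto simp: cycle_def)
  also have "emeasure (P x) \<dots> = emeasure (P x) E * emeasure (P a) ?C"
    by (rule strong_Markov_hit[OF P x a fin(1) E C])
  also have "emeasure (P a) ?C = emeasure (P a) Omega * emeasure (P x) B"
    by (rule strong_Markov_hit[OF P a x fin(2) O B])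
  also have "emeasure (P a) Omega = 1"
    using prob_space.emeasure_space_1[OF diffusion_prob_space(1)[OF P a]] diffusion_prob_space(3)[OF P a] by simp
  finally show ?thesis by simp
qed

lemma nn_integral_cycle:
  assumes P: "diffusion s m P" and x: "0 < x" and a: "0 < a"
    and fin: "AE \<omega> in P x. hit a \<omega> < \<top>" "AE \<omega> in P a. hit x \<omega> < \<top>"
    and E: "E \<in> sets (Filt.pre_sigma (hit a))" and f: "f \<in> borel_measurable F_inf"
  shows "(\<integral>\<^sup>+ \<omega>. indicator E \<omega> * f (cycle x a \<omega>) \<partial>P x) = emeasure (P x) E * (\<integral>\<^sup>+ \<omega>. f \<omega> \<partial>P x)"
proof -
  note Px = diffusion_prob_space[OF P x]
  have EF: "E \<in> sets (P x)" using pre_sigma_hit_F_inf[OF a E] Px by simp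
  have fP: "f \<in> borel_measurable (P x)"
    using f measurable_cong_sets[OF Px(2) refl] by blast
  have c: "cycle x a \<in> measurable (P x) F_inf"
    using cycle_measurable[OF x a] measurable_cong_sets[OF Px(2) refl] by blast
  then have cd: "cycle x a \<in> measurable (density (P x) (indicator E)) F_inf" by simp
  have "distr (density (P x) (indicator E)) F_inf (cycle x a) = scale_measure (emeasure (P x) E) (P x)"
  proof (rule measure_eqI)
    fix B assume "B \<in> sets (distr (density (P x) (indicator E)) F_inf (cycle x a))"
    then have B: "B \<in> sets F_inf" by simp
    have V: "cycle x a -` B \<inter> space (P x) \<in> sets (P x)"
      using c B by (rule measurable_sets)
    have "emeasure (density (P x) (indicator E)) (cycle x a -` B \<inter> space (P x))
        = (\<integral>\<^sup>+ \<omega>. indicator (E \<inter> cycle x a -` B) \<omega> \<partial>P x)"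
      using V EF sets.sets_into_space[OF EF]
      by (subst emeasure_density) (auto intro!: nn_integral_cong simp: indicator_def)
    also have "\<dots> = emeasure (P x) (E \<inter> cycle x a -` B)"
    proof (rule nn_integral_indicator)
      have "E \<inter> cycle x a -` B = E \<inter> (cycle x a -` B \<inter> space (P x))"
        using sets.sets_into_space[OF EF] by auto
      then show "E \<inter> cycle x a -` B \<in> sets (P x)" using V EF by auto
    qed
    finally show "emeasure (distr (density (P x) (indicator E)) F_inf (cycle x a)) B
       = emeasure (scale_measure (emeasure (P x) E) (P x)) B"
      using B emeasure_cycle[OF P x a fin E B] by (simp add: emeasure_distr[OF cd])
  qed (simp add: Px)
  then have "(\<integral>\<^sup>+ \<omega>. f \<omega> \<partial>distr (density (P x) (indicator E)) F_inf (cycle x a))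
     = emeasure (P x) E * (\<integral>\<^sup>+ \<omega>. f \<omega> \<partial>P x)"
    by (simp add: nn_integral_scale_measure[OF fP])
  then show ?thesis
    using EF f c cd by (simp add: nn_integral_distr nn_integral_density)
qed

text \<open>
  Likelihood ratios, and their powers, of \<open>n\<close> repeated Bernoulli trials have this form; a trial
  succeeds if the current iterate of \<open>\<theta>\<close> lies in \<open>E\<close>.
\<close>

primrec cycle_weight :: "('a \<Rightarrow> 'a) \<Rightarrow> 'a set \<Rightarrow> real \<Rightarrow> real \<Rightarrow> nat \<Rightarrow> 'a \<Rightarrow> real" where
  "cycle_weight \<theta> E u v 0 \<omega> = 1"
| "cycle_weight \<theta> E u v (Suc n) \<omega> = (if \<omega> \<in> E then u else v) * cycle_weight \<theta> E u v n (\<theta> \<omega>)"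

lemma cycle_weight_measurable:
  assumes "\<theta> \<in> measurable M M" "E \<in> sets M"
  shows "cycle_weight \<theta> E u v n \<in> borel_measurable M"
proof (induction n)
  case 0
  then show ?case by simp
next
  case (Suc n)
  note [measurable] = Suc assms
  show ?case by simp measurable
qed

lemma cycle_weight_nonneg: "0 \<le> u \<Longrightarrow> 0 \<le> v \<Longrightarrow> 0 \<le> cycle_weight \<theta> E u v n \<omega>"
  by (induction n arbitrary: \<omega>) auto

lemma cycle_weight_inverse:
  "0 < u \<Longrightarrow> 0 < v \<Longrightarrow> cycle_weight \<theta> E u v n \<omega> * cycle_weight \<theta> E (1 / u) (1 / v) n \<omega> = 1"
  by (induction n arbitrary: \<omega>) auto

text \<open>
  The factor of the first cycle is independent of the product over the remaining ones, which has the
  same law as a product over one cycle less.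
\<close>

lemma nn_integral_cycle_weight:
  assumes P: "diffusion s m P" and x: "0 < x" and a: "0 < a"
    and fin: "AE \<omega> in P x. hit a \<omega> < \<top>" "AE \<omega> in P a. hit x \<omega> < \<top>"
    and E: "E \<in> sets (Filt.pre_sigma (hit a))" and uv: "0 \<le> u" "0 \<le> v"
    and p: "measure (P x) E = p"
  shows "(\<integral>\<^sup>+ \<omega>. ennreal (cycle_weight (cycle x a) E u v n \<omega>) \<partial>P x) = ennreal ((p * u + (1 - p) * v) ^ n)"
proof (induction n)
  interpret prob_space "P x" by (rule diffusion_prob_space[OF P x])
  case 0
  show ?case by (simp add: emeasure_space_1)
next
  interpret prob_space "P x" by (rule diffusion_prob_space[OF P x])
  note Px = diffusion_prob_space[OF P x]
  case (Suc n)
  let ?W = "\<lambda>n \<omega>. ennreal (cycle_weight (cycle x a) E u v n \<omega>)"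
  have EF: "E \<in> sets F_inf" by (rule pre_sigma_hit_F_inf[OF a E])
  have E': "Omega - E \<in> sets (Filt.pre_sigma (hit a))"
    using sets.compl_sets[OF E] by (simp add: Filt.space_pre_sigma)
  have W: "?W n \<in> borel_measurable F_inf"
    using cycle_weight_measurable[OF cycle_measurable[OF x a] EF] by simp
  have WP: "(\<lambda>\<omega>. ?W n (cycle x a \<omega>)) \<in> borel_measurable (P x)"
    using measurable_compose[OF cycle_measurable[OF x a] W] measurable_cong_sets[OF Px(2) refl] by blast
  have EP: "E \<in> events" "Omega - E \<in> events"
    using EF sets.compl_sets[OF EF] Px by auto
  have p01: "0 \<le> p" "p \<le> 1" using p by auto
  have "(\<integral>\<^sup>+ \<omega>. ?W (Suc n) \<omega> \<partial>P x) =
     (\<integral>\<^sup>+ \<omega>. ennreal u * (indicator E \<omega> * ?W n (cycle x a \<omega>))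
          + ennreal v * (indicator (Omega - E) \<omega> * ?W n (cycle x a \<omega>)) \<partial>P x)"
    using uv Px by (intro nn_integral_cong) (auto simp: ennreal_mult cycle_weight_nonneg)
  also have "\<dots> = ennreal u * (emeasure (P x) E * (\<integral>\<^sup>+ \<omega>. ?W n \<omega> \<partial>P x))
      + ennreal v * (emeasure (P x) (Omega - E) * (\<integral>\<^sup>+ \<omega>. ?W n \<omega> \<partial>P x))"
    using WP EP nn_integral_cycle[OF P x a fin E W] nn_integral_cycle[OF P x a fin E' W]
    by (simp add: nn_integral_add nn_integral_cmult)
  also have "\<dots> = ennreal u * (ennreal p * ennreal ((p * u + (1 - p) * v) ^ n))
      + ennreal v * (ennreal (1 - p) * ennreal ((p * u + (1 - p) * v) ^ n))"
    using Suc.IH prob_compl[OF EP(1)] p Px by (simp add: emeasure_eq_measure)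
  also have "\<dots> = ennreal ((p * u + (1 - p) * v) ^ Suc n)"
    using uv p01 by (simp add: ennreal_mult[symmetric] ennreal_plus[symmetric] del: ennreal_plus) (simp add: algebra_simps)
  finally show ?case .
qed

lemma sqrt_affinity_less_1:
  assumes "0 \<le> p" "p \<le> 1" "0 \<le> q" "q \<le> 1" "p \<noteq> q"
  shows "sqrt (p * q) + sqrt ((1 - p) * (1 - q)) < 1"
proof -
  have "0 < (sqrt p - sqrt q)\<^sup>2" using assms by simp
  then have "2 * sqrt (p * q) < p + q"
    using assms by (simp add: power2_diff real_sqrt_mult)
  moreover have "sqrt ((1 - p) * (1 - q)) \<le> ((1 - p) + (1 - q)) / 2"
    using assms by (intro arith_geo_mean_sqrt) auto
  ultimately show ?thesis by (simp add: field_simps)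
qed

text \<open>
  The weights \<open>u = sqrt (q / p)\<close> and \<open>v = sqrt ((1 - q) / (1 - p))\<close> are the square roots of the likelihood
  ratio of one trial. With them the mean of the product over \<open>k\<close> cycles under \<open>P x\<close>, and the mean of
  its reciprocal under \<open>Q x\<close>, are both the \<open>k\<close>-th power of the affinity \<open>h\<close>.
\<close>

lemma recurrent_recurrent_singular:
  assumes P: "diffusion s m P" and Q: "diffusion r n Q" and x: "0 < x" and a: "0 < a"
    and Pfin: "AE \<omega> in P x. hit a \<omega> < \<top>" "AE \<omega> in P a. hit x \<omega> < \<top>"
    and Qfin: "AE \<omega> in Q x. hit a \<omega> < \<top>" "AE \<omega> in Q a. hit x \<omega> < \<top>"
    and E: "E \<in> sets (Filt.pre_sigma (hit a))"
    and p: "measure (P x) E = p" "0 < p" "p < 1" and q: "measure (Q x) E = q" "0 < q" "q < 1"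
    and ne: "p \<noteq> q"
  shows "singular_on F_inf (P x) (Q x)"
proof (rule singular_on_approx)
  fix e :: real assume e: "0 < e"
  define h where "h = sqrt (p * q) + sqrt ((1 - p) * (1 - q))"
  define u where "u = sqrt (q / p)"
  define v where "v = sqrt ((1 - q) / (1 - p))"
  have uv: "0 < u" "0 < v" using p q by (auto simp: u_def v_def)
  have sqrt_ratio: "y * sqrt (z / y) = sqrt (y * z)" if "0 < y" for y z :: real
  proof -
    have "y * sqrt (z / y) = sqrt (y\<^sup>2 * (z / y))"
      using that by (subst real_sqrt_mult) simp
    also have "y\<^sup>2 * (z / y) = y * z"
      using that by (simp add: power2_eq_square)
    finally show ?thesis .
  qed
  have Pu: "p * u + (1 - p) * v = h"
    using sqrt_ratio[of p q] sqrt_ratio[of "1 - p" "1 - q"] p by (simp add: u_def v_def h_def)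
  have "1 / u = sqrt (p / q)" "1 / v = sqrt ((1 - p) / (1 - q))"
    by (simp_all add: u_def v_def real_sqrt_divide)
  then have Qu: "q * (1 / u) + (1 - q) * (1 / v) = h"
    using sqrt_ratio[of q p] sqrt_ratio[of "1 - q" "1 - p"] q by (simp only: h_def) (simp add: mult.commute)
  have h: "0 \<le> h" "h < 1"
    using sqrt_affinity_less_1[of p q] p q ne by (auto simp: h_def)
  then obtain k where k: "h ^ k < e"
    using real_arch_pow_inv[of e h] e by blast
  let ?\<theta> = "cycle x a"
  have EF: "E \<in> sets F_inf" by (rule pre_sigma_hit_F_inf[OF a E])
  note W = cycle_weight_measurable[OF cycle_measurable[OF x a] EF]
  let ?W = "cycle_weight ?\<theta> E u v k" and ?V = "cycle_weight ?\<theta> E (1 / u) (1 / v) k"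
  define B where "B = {\<omega> \<in> Omega. 1 \<le> ?W \<omega>}"
  have Bs: "B \<in> sets F_inf"
    using borel_measurable_le[OF borel_measurable_const W, of 1 u v k] by (simp add: B_def)
  have Markov: "emeasure M {\<omega> \<in> Omega. 1 \<le> f \<omega>} \<le> (\<integral>\<^sup>+ \<omega>. ennreal (f \<omega>) \<partial>M)"
    if "f \<in> borel_measurable F_inf" "sets M = sets F_inf" for f :: "path \<Rightarrow> real" and M
  proof -
    have sp: "space M = Omega" using sets_eq_imp_space_eq[OF that(2)] by simp
    have fM: "f \<in> borel_measurable M" using that measurable_cong_sets[OF that(2) refl] by blast
    have "emeasure M {\<omega> \<in> space M. 1 \<le> 1 * ennreal (f \<omega>)} \<le> 1 * (\<integral>\<^sup>+ \<omega>. ennreal (f \<omega>) * indicator (space M) \<omega> \<partial>M)"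
      using fM by (intro nn_integral_Markov_inequality) auto
    also have "(\<integral>\<^sup>+ \<omega>. ennreal (f \<omega>) * indicator (space M) \<omega> \<partial>M) = (\<integral>\<^sup>+ \<omega>. ennreal (f \<omega>) \<partial>M)"
      by (intro nn_integral_cong) auto
    finally show ?thesis using sp by simp
  qed
  note Px = diffusion_prob_space[OF P x] and Qx = diffusion_prob_space[OF Q x]
  have "emeasure (P x) B \<le> ennreal (h ^ k)"
    using Markov[OF W Px(2), of u v k] nn_integral_cycle_weight[OF P x a Pfin E _ _ p(1), of u v k] uv
    by (simp add: B_def Pu)
  moreover have "emeasure (Q x) (space F_inf - B) \<le> ennreal (h ^ k)"
  proof -
    have "1 \<le> ?V \<omega>" if "\<not> 1 \<le> ?W \<omega>" for \<omega>
    proof -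
      have "?W \<omega> * ?V \<omega> \<le> 1 * ?V \<omega>"
        using that uv by (intro mult_right_mono cycle_weight_nonneg) auto
      then show ?thesis
        using cycle_weight_inverse[OF uv, of ?\<theta> E k \<omega>] by simp
    qed
    then have "emeasure (Q x) (space F_inf - B) \<le> emeasure (Q x) {\<omega> \<in> Omega. 1 \<le> ?V \<omega>}"
      using borel_measurable_le[OF borel_measurable_const W, of 1 "1 / u" "1 / v" k] Qx
      by (intro emeasure_mono) (auto simp: B_def)
    also have "\<dots> \<le> ennreal (h ^ k)"
      using Markov[OF W Qx(2), of "1 / u" "1 / v" k]
        nn_integral_cycle_weight[OF Q x a Qfin E _ _ q(1), of "1 / u" "1 / v" k] uv
      by (simp only: Qu) simp
    finally show ?thesis .
  qed
  moreover have "ennreal (h ^ k) < ennreal e"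
    using k e by (simp add: ennreal_lessI)
  ultimately show "\<exists>B\<in>sets F_inf. emeasure (P x) B < ennreal e \<and> emeasure (Q x) (space F_inf - B) < ennreal e"
    using Bs by (intro bexI[of _ B]) (auto intro: order.strict_trans1)
qed (use diffusion_prob_space[OF P x] diffusion_prob_space[OF Q x] in auto)

section \<open>Singularity of the transforms\<close>

theorem theorem6p6:
  fixes m :: "real measure"
    and P P\<alpha> P\<beta> :: "real \<Rightarrow> path measure"
    and \<alpha> \<beta> :: "real \<Rightarrow> real"
  assumes "radon_full_support m"
    and "regular_0 m \<or> exit_0 m"
    and "entrance_inf m \<or> natural_inf m"
    and "diffusion (\<lambda>x. x) m P"
    and "killed_at_0 P"
    and "\<alpha> \<in> class_C m" and "\<beta> \<in> class_C m"
    and "h_transform m P \<alpha> P\<alpha>" and "h_transform m P \<beta> P\<beta>"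
    and "\<not> (\<exists>c. \<forall>x>0. \<alpha> x = c * \<beta> x)"
    and "(\<integral>\<^sup>+ x \<in> {1<..}. ennreal (1 / (\<alpha> x)\<^sup>2) \<partial>lborel) = \<infinity>"
  shows "\<forall>x>0. singular_on F_inf (P\<alpha> x) (P\<beta> x)"
proof (intro allI impI)
  fix x :: real assume x: "0 < x"
  have m: "sets m = sets borel_pos"
    using assms(1) by (simp add: radon_full_support_def)
  have scale: "continuous_on {0<..} \<rho> \<and> (\<forall>x>0. 0 < \<rho> x) \<and> filterlim (h_scale \<rho>) at_bot (at_right 0)"
    if \<rho>: "\<rho> \<in> class_C m" for \<rho>
  proof -
    obtain C where C: "0 < C" "\<And>x. 0 < x \<Longrightarrow> \<rho> x \<le> C * x" "C-lipschitz_on {0<..} \<rho>"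
      using class_C_Lipschitz[OF m \<rho>] by blast
    have cont: "continuous_on {0<..} \<rho>"
      using C(3) by (rule lipschitz_on_continuous_on)
    have pos: "0 < \<rho> x" if "0 < x" for x
      using \<rho> that by (auto simp: class_C_def)
    from h_scale_at_0[OF cont pos C(1,2)] cont pos show ?thesis by blast
  qed
  note \<alpha> = scale[OF assms(6)] and \<beta> = scale[OF assms(7)]
  have \<alpha>c: "continuous_on {0<..} \<alpha>" "\<And>x. 0 < x \<Longrightarrow> 0 < \<alpha> x" using \<alpha> by auto
  have \<beta>c: "continuous_on {0<..} \<beta>" "\<And>x. 0 < x \<Longrightarrow> 0 < \<beta> x" using \<beta> by auto
  have \<alpha>_mono: "strict_mono_on {0<..} (h_scale \<alpha>)" and \<beta>_mono: "strict_mono_on {0<..} (h_scale \<beta>)"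
    using h_scale_strict_mono \<alpha>c \<beta>c by blast+
  have \<alpha>_bot: "filterlim (h_scale \<alpha>) at_bot (at_right 0)" and \<beta>_bot: "filterlim (h_scale \<beta>) at_bot (at_right 0)"
    using \<alpha> \<beta> by auto
  have \<alpha>_top: "filterlim (h_scale \<alpha>) at_top at_top"
    by (rule h_scale_at_top[OF \<alpha>c assms(11)])
  have D: "diffusion (h_scale \<alpha>) (h_speed m \<alpha>) P\<alpha>" "diffusion (h_scale \<beta>) (h_speed m \<beta>) P\<beta>"
    using assms(8,9) by (auto simp: h_transform_def)
  from mono_at_top_or_bounded[OF strict_mono_on_imp_mono_on[OF \<beta>_mono]]
  show "singular_on F_inf (P\<alpha> x) (P\<beta> x)"
  proof (elim disjE exE)
    fix K assume "\<forall>y>0. h_scale \<beta> y \<le> K"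
    then show ?thesis
      by (intro recurrent_transient_singular[OF D(1) \<alpha>_mono \<alpha>_top \<alpha>_bot D(2) \<beta>_mono _ \<beta>_bot x]) auto
  next
    assume \<beta>_top: "filterlim (h_scale \<beta>) at_top at_top"
    obtain a b where ab: "0 < a" "a < x" "x < b"
      and ne: "(h_scale \<alpha> b - h_scale \<alpha> x) / (h_scale \<alpha> b - h_scale \<alpha> a) \<noteq>
        (h_scale \<beta> b - h_scale \<beta> x) / (h_scale \<beta> b - h_scale \<beta> a)"
      using exit_ratio_differs[OF \<alpha>c \<beta>c assms(10) x] by blast
    let ?E = "{\<omega> \<in> Omega. hit a \<omega> < hit b \<omega>}"
    have E: "?E \<in> sets (Filt.pre_sigma (hit a))"
      using Filt.stopping_time_less[OF stopping_time_hit stopping_time_hit, of a b] ab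
      by (simp add: pred_def Filt.space_pre_sigma)
    have \<alpha>s: "h_scale \<alpha> a < h_scale \<alpha> x" "h_scale \<alpha> x < h_scale \<alpha> b"
      using strict_mono_onD[OF \<alpha>_mono, of a x] strict_mono_onD[OF \<alpha>_mono, of x b] ab by auto
    have \<beta>s: "h_scale \<beta> a < h_scale \<beta> x" "h_scale \<beta> x < h_scale \<beta> b"
      using strict_mono_onD[OF \<beta>_mono, of a x] strict_mono_onD[OF \<beta>_mono, of x b] ab by auto
    show ?thesis
    proof (rule recurrent_recurrent_singular[OF D x ab(1) _ _ _ _ E
          diffusion_exit(1)[OF D(1) ab] _ _ diffusion_exit(1)[OF D(2) ab] _ _ ne])
      show "AE \<omega> in P\<alpha> x. hit a \<omega> < \<top>" "AE \<omega> in P\<alpha> a. hit x \<omega> < \<top>"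
        by (rule recurrent_hits[OF D(1) \<alpha>_mono \<alpha>_top \<alpha>_bot]; use ab x in simp)+
      show "AE \<omega> in P\<beta> x. hit a \<omega> < \<top>" "AE \<omega> in P\<beta> a. hit x \<omega> < \<top>"
        by (rule recurrent_hits[OF D(2) \<beta>_mono \<beta>_top \<beta>_bot]; use ab x in simp)+
    qed (use \<alpha>s \<beta>s in auto)
  qed
qed

end
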